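(* Let $0<\alpha<2$, let $p>-1$ and let $u_p(x)=(1-x^2)^p$ for $x\in(-1,1)$. Then for every $x\in(-1,1)$, $$ Lu_p(x)=\frac{(1-x^2)^{p-\alpha}}{\alpha}\Big((1-x)^\alpha+(1+x)^\alpha-(2p+2-\alpha)\,B(p+1,1-\alpha/2)+\alpha\, I(p)\Big), $$ where $$ I(p)=\mathrm{p.v.}\int_{-1}^1\frac{(1-wx)^{\alpha-1-2p}-1}{|w|^{1+\alpha}}\,(1-w^2)^p\,dw . $$ Moreover, $$ I\left(\tfrac{\alpha-3}{2}\right)=x^2B(p+1,1-\alpha/2)\ \text{ with } p=\tfrac{\alpha-3}{2},\quad\text{if }1<\alpha<2, $$ and $$ I\left(\tfrac{\alpha-2}{2}\right)=I\left(\tfrac{\alpha-1}{2}\right)=0 . $$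
   Context: For a function $u$ on $(-1,1)$, $$Lu(x)=\lim_{\varepsilon\to0^+}\int_{(-1,1)\cap\{|y-x|>\varepsilon\}}\frac{u(y)-u(x)}{|x-y|^{1+\alpha}}\,dy,\qquad x\in(-1,1).$$ The principal value is $\mathrm{p.v.}\int_{-1}^1 f(w)\,dw=\lim_{\varepsilon\to0^+}\int_{(-1,1)\cap\{|w|>\varepsilon\}}f(w)\,dw$. $B$ is the Euler beta function. The quantity $I(p)$ depends on $x$ and $\alpha$ as well as on $p$. *)

theory Defs
  imports "HOL-Analysis.Analysis"
begin

definition pv_trunc :: "real \<Rightarrow> real \<Rightarrow> real set" where
  "pv_trunc c \<epsilon> = {-1<..<1} \<inter> {y. \<bar>y - c\<bar> > \<epsilon>}"

definition pv_integral :: "real \<Rightarrow> (real \<Rightarrow> real) \<Rightarrow> real" where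
  "pv_integral c f = Lim (at_right 0) (\<lambda>\<epsilon>. LINT y:pv_trunc c \<epsilon>|lebesgue. f y)"

(* Both Lim and the Lebesgue integral are total (with a junk value) in HOL, so an equation
   about pv_integral c f carries its usual meaning only together with pv_convergent c f. *)
definition pv_convergent :: "real \<Rightarrow> (real \<Rightarrow> real) \<Rightarrow> bool" where
  "pv_convergent c f \<longleftrightarrow>
     (\<forall>\<epsilon>>0. set_integrable lebesgue (pv_trunc c \<epsilon>) f) \<and>
     (\<exists>l. ((\<lambda>\<epsilon>. LINT y:pv_trunc c \<epsilon>|lebesgue. f y) \<longlongrightarrow> l) (at_right 0))"

definition L_integrand :: "real \<Rightarrow> (real \<Rightarrow> real) \<Rightarrow> real \<Rightarrow> real \<Rightarrow> real" where
  "L_integrand \<alpha> u x y = (u y - u x) / \<bar>x - y\<bar> powr (1 + \<alpha>)"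

definition L_op :: "real \<Rightarrow> (real \<Rightarrow> real) \<Rightarrow> real \<Rightarrow> real" where
  "L_op \<alpha> u x = pv_integral x (L_integrand \<alpha> u x)"

(* Only the values on (-1,1), where the base of powr is positive, are relevant. *)
definition u_pow :: "real \<Rightarrow> real \<Rightarrow> real" where
  "u_pow p x = (1 - x\<^sup>2) powr p"

definition I_integrand :: "real \<Rightarrow> real \<Rightarrow> real \<Rightarrow> real \<Rightarrow> real" where
  "I_integrand \<alpha> x p w =
     ((1 - w * x) powr (\<alpha> - 1 - 2 * p) - 1) / \<bar>w\<bar> powr (1 + \<alpha>) * (1 - w\<^sup>2) powr p"

definition I_pv :: "real \<Rightarrow> real \<Rightarrow> real \<Rightarrow> real" where
  "I_pv \<alpha> x p = pv_integral 0 (I_integrand \<alpha> x p)"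

end

theory Submission
  imports Defs
begin

text \<open>
  Fix \<open>x\<close> and substitute \<open>y = (x - w) / (1 - w x)\<close>, a Moebius involution of \<open>(-1,1)\<close> that sends
  \<open>w = 0\<close> to \<open>y = x\<close>.  It is chosen because all three ingredients of the integrand transform by
  factors of the same kind:
  \<open>1 - y\<^sup>2 = (1 - x\<^sup>2)(1 - w\<^sup>2) / (1 - w x)\<^sup>2\<close>, \<open>x - y = w (1 - x\<^sup>2) / (1 - w x)\<close> and
  \<open>dy = - (1 - x\<^sup>2) / (1 - w x)\<^sup>2 dw\<close>.  Collecting powers, the integrand of \<open>L u\<^sub>p(x)\<close> becomes
  \<open>(1 - x\<^sup>2)\<^bsup>p - \<alpha>\<^esup>\<close> times
  \<open>((1 - w x)\<^bsup>\<alpha> - 1 - 2p\<^esup> (1 - w\<^sup>2)\<^bsup>p\<^esup> - (1 - w x)\<^bsup>\<alpha> - 1\<^esup>) / |w|\<^bsup>1 + \<alpha>\<^esup>\<close>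
  (\<open>L_integrand_moebius\<close>).  Adding and subtracting \<open>(1 - w\<^sup>2)\<^bsup>p\<^esup>\<close> in the numerator splits this into
  the integrand of \<open>I(p)\<close> and the difference of the two kernels \<open>(1 - w\<^sup>2)\<^bsup>p\<^esup> / |w|\<^bsup>1 + \<alpha>\<^esup>\<close> and
  \<open>(1 - w x)\<^bsup>\<alpha> - 1\<^esup> / |w|\<^bsup>1 + \<alpha>\<^esup>\<close>.

  The two kernels can be integrated explicitly over \<open>\<delta> < |w| < 1\<close>.  The derivative of
  \<open>w\<^bsup>-\<alpha>\<^esup> (1 - w\<^sup>2)\<^bsup>p + 1\<^esup>\<close> is a combination of the first kernel and of the integrable function
  \<open>w\<^bsup>1 - \<alpha>\<^esup> (1 - w\<^sup>2)\<^bsup>p\<^esup>\<close>, whose integral is a beta value; and \<open>w\<^bsup>-\<alpha>\<^esup> (1 - w x)\<^bsup>\<alpha>\<^esup>\<close> is, up to the factor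
  \<open>-\<alpha>\<close>, a primitive of the second kernel.  Each integral blows up like \<open>\<delta>\<^bsup>-\<alpha>\<^esup>\<close>, but the coefficients
  cancel up to \<open>O(\<delta>\<^sup>2)\<close>, and \<open>\<alpha> < 2\<close> makes the remainder vanish; what survives is the bracket of the
  formula without \<open>I(p)\<close> (\<open>pv_kernel_difference_tendsto\<close>).  The principal value \<open>I(p)\<close> exists because
  adding the values at \<open>w\<close> and \<open>-w\<close> replaces \<open>(1 - w x)\<^bsup>q\<^esup> - 1\<close> by a second difference, which is \<open>O(w\<^sup>2)\<close>
  (\<open>I_integrand_tendsto\<close>).

  One point needs care: the substitution turns \<open>|y - x| > \<epsilon>\<close> into a set that is not symmetric about
  \<open>0\<close> when \<open>x \<noteq> 0\<close>.  Its boundary points differ from symmetric ones by \<open>O(\<epsilon>\<^sup>2)\<close>, and the transformed integrand is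
  only \<open>O(|w|\<^bsup>-\<alpha>\<^esup>)\<close> since its numerator vanishes at \<open>0\<close>.  Replacing one truncation by the other
  therefore costs \<open>O(\<epsilon>\<^bsup>2 - \<alpha>\<^esup>)\<close>, which tends to \<open>0\<close> (\<open>moebius_trunc_tendsto\<close>).

  The special values belong to the exponents \<open>\<alpha> - 1 - 2p \<in> {2, 1, 0}\<close>, for which the second difference is
  exactly \<open>2 x\<^sup>2 w\<^sup>2\<close>, \<open>0\<close> and \<open>0\<close>.
\<close>

section \<open>Symmetric truncations\<close>

lemma open_pv_trunc: "open (pv_trunc c \<epsilon>)"
proof -
  have "open {y. \<bar>y - c\<bar> > \<epsilon>}"
    by (intro open_Collect_less continuous_intros)
  then show ?thesis
    by (auto simp: pv_trunc_def)
qed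

lemma sets_pv_trunc [simp]: "pv_trunc c \<epsilon> \<in> sets lebesgue"
  using open_pv_trunc [of c \<epsilon>] by auto

lemma pv_trunc_0_eq:
  assumes "\<delta> \<ge> 0"
  shows "pv_trunc 0 \<delta> = {\<delta><..<1} \<union> uminus ` {\<delta><..<1}"
  using assms by (auto simp: pv_trunc_def)

lemma integral_uminus_image:
  fixes f :: "real \<Rightarrow> real"
  assumes "S \<in> sets lebesgue"
  shows "f absolutely_integrable_on uminus ` S \<and> integral (uminus ` S) f = b \<longleftrightarrow>
    (\<lambda>w. f (- w)) absolutely_integrable_on S \<and> integral S (\<lambda>w. f (- w)) = b"
proof -
  have "(uminus has_real_derivative - 1) (at w within S)" for w
    by (auto intro!: derivative_eq_intros)
  from has_absolute_integral_change_of_variables_1' [OF assms this, of f b] show ?thesis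
    by (simp add: inj_on_def)
qed

text \<open>
  Odd contributions cancel here before any limit is taken; this is the mechanism behind the existence
  of the principal values and behind the special values of \<open>I(p)\<close>.
\<close>

lemma integral_pv_trunc_fold:
  fixes f :: "real \<Rightarrow> real"
  assumes "f absolutely_integrable_on pv_trunc 0 \<delta>" "\<delta> \<ge> 0"
  shows "(LINT w:pv_trunc 0 \<delta>|lebesgue. f w) = integral {\<delta><..<1} (\<lambda>w. f w + f (- w))"
proof -
  have sub: "f absolutely_integrable_on {\<delta><..<1}" "f absolutely_integrable_on uminus ` {\<delta><..<1}"
    using assms by (auto intro!: set_integrable_subset [OF assms(1)] simp: pv_trunc_0_eq)
  then have refl: "(\<lambda>w. f (- w)) absolutely_integrable_on {\<delta><..<1}"
      "integral (uminus ` {\<delta><..<1}) f = integral {\<delta><..<1} (\<lambda>w. f (- w))"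
    using integral_uminus_image [of "{\<delta><..<1}" f] by auto
  have "{\<delta><..<1} \<inter> uminus ` {\<delta><..<1} = {}"
    using assms(2) by auto
  then have neg: "negligible ({\<delta><..<1} \<inter> uminus ` {\<delta><..<1})"
    by (metis negligible_empty)
  have "(LINT w:pv_trunc 0 \<delta>|lebesgue. f w) = integral (pv_trunc 0 \<delta>) f"
    using assms(1) by (rule set_lebesgue_integral_eq_integral)
  also have "\<dots> = integral {\<delta><..<1} f + integral (uminus ` {\<delta><..<1}) f"
    unfolding pv_trunc_0_eq [OF assms(2)]
    using sub neg by (intro integral_Un) (auto intro: set_lebesgue_integral_eq_integral(1))
  also have "\<dots> = integral {\<delta><..<1} (\<lambda>w. f w + f (- w))"
    unfolding refl(2) using sub(1) refl(1)
    by (intro Henstock_Kurzweil_Integration.integral_add [symmetric])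
       (auto intro: set_lebesgue_integral_eq_integral(1))
  finally show ?thesis .
qed

lemma integral_truncate_left_tendsto:
  fixes f :: "real \<Rightarrow> real"
  assumes "f integrable_on {0<..<1}"
  shows "((\<lambda>\<delta>. integral {\<delta><..<1} f) \<longlongrightarrow> integral {0<..<1} f) (at_right 0)"
proof -
  have "continuous_on {0..1} (\<lambda>\<delta>. integral {\<delta>..1} f)"
    using assms by (intro indefinite_integral_continuous_1') (simp add: integrable_on_open_interval_real)
  then have "((\<lambda>\<delta>. integral {\<delta>..1} f) \<longlongrightarrow> integral {0..1} f) (at 0 within {0..1})"
    by (simp add: continuous_on_def)
  then have "((\<lambda>\<delta>. integral {\<delta>..1} f) \<longlongrightarrow> integral {0..1} f) (at_right 0)"
    using at_within_Icc_at_right [of 0 "1::real"] by simp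
  then show ?thesis
    by (simp only: integral_open_interval_real)
qed

lemma pv_integralI:
  assumes "((\<lambda>\<epsilon>. LINT y:pv_trunc c \<epsilon>|lebesgue. f y) \<longlongrightarrow> l) (at_right 0)"
  shows "pv_integral c f = l"
  unfolding pv_integral_def using assms by (intro tendsto_Lim) auto

section \<open>The singular kernel and the beta density\<close>

text \<open>
  The substitution \<open>t = w\<^sup>2\<close> turns this into the density \<open>t\<^bsup>-\<alpha>/2\<^esup> (1 - t)\<^bsup>p\<^esup>\<close> of the beta function.  It is
  the kernel below multiplied by \<open>w\<^sup>2\<close>, and it serves as the integrable majorant throughout.
\<close>

definition beta_density :: "real \<Rightarrow> real \<Rightarrow> real \<Rightarrow> real" where
  "beta_density \<alpha> p w = \<bar>w\<bar> powr (1 - \<alpha>) * (1 - w\<^sup>2) powr p"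

definition pv_kernel :: "real \<Rightarrow> real \<Rightarrow> real \<Rightarrow> real" where
  "pv_kernel \<alpha> p w = (1 - w\<^sup>2) powr p / \<bar>w\<bar> powr (1 + \<alpha>)"

lemma beta_density_minus [simp]: "beta_density \<alpha> p (- w) = beta_density \<alpha> p w"
  by (simp add: beta_density_def)

lemma pv_kernel_minus [simp]: "pv_kernel \<alpha> p (- w) = pv_kernel \<alpha> p w"
  by (simp add: pv_kernel_def)

lemma pv_kernel_eq_beta_density:
  assumes "w \<noteq> 0"
  shows "pv_kernel \<alpha> p w = beta_density \<alpha> p w / w\<^sup>2"
proof -
  have "\<bar>w\<bar> powr (1 - \<alpha>) * \<bar>w\<bar> powr (1 + \<alpha>) = \<bar>w\<bar> powr 2"
    by (simp add: powr_add [symmetric])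
  also have "\<dots> = w\<^sup>2"
    using assms by simp
  finally show ?thesis
    using assms by (simp add: pv_kernel_def beta_density_def field_simps)
qed

lemma square_image_unit_interval: "(\<lambda>w::real. w\<^sup>2) ` {0<..<1} = {0<..<1}"
proof
  show "(\<lambda>w::real. w\<^sup>2) ` {0<..<1} \<subseteq> {0<..<1}"
    by (auto simp: power_less_one_iff)
  show "{0<..<1} \<subseteq> (\<lambda>w::real. w\<^sup>2) ` {0<..<1}"
  proof
    fix t :: real assume "t \<in> {0<..<1}"
    then show "t \<in> (\<lambda>w. w\<^sup>2) ` {0<..<1}"
      by (intro image_eqI [of _ _ "sqrt t"]) auto
  qed
qed

text \<open>
  Substituting \<open>t = w\<^sup>2\<close> in Euler's integral on the open unit interval.
\<close>

lemma beta_density_integral: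
  assumes "\<alpha> < 2" "p > -1"
  shows "beta_density \<alpha> p absolutely_integrable_on {0<..<1}"
    and "2 * integral {0<..<1} (beta_density \<alpha> p) = Beta (p + 1) (1 - \<alpha> / 2)"
proof -
  define f where "f t = t powr (- \<alpha> / 2) * (1 - t) powr p" for t :: real
  have "(f has_integral Beta (1 - \<alpha> / 2) (p + 1)) {0<..<1}"
    using has_integral_Beta_real [of "1 - \<alpha> / 2" "p + 1"] assms
    by (simp add: f_def [abs_def] has_integral_Icc_iff_Ioo)
  then have int: "f integrable_on {0<..<1}"
    and val: "integral {0<..<1} f = Beta (1 - \<alpha> / 2) (p + 1)"
    by (auto simp: has_integral_iff)
  have "f absolutely_integrable_on {0<..<1}"
    using int by (rule nonnegative_absolutely_integrable_1) (auto simp: f_def)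
  then have "f absolutely_integrable_on (\<lambda>w. w\<^sup>2) ` {0<..<1} \<and>
      integral ((\<lambda>w. w\<^sup>2) ` {0<..<1}) f = Beta (1 - \<alpha> / 2) (p + 1)"
    by (simp add: val square_image_unit_interval)
  moreover have "((\<lambda>w. \<bar>2 * w\<bar> * f (w\<^sup>2)) absolutely_integrable_on {0<..<1} \<and>
      integral {0<..<1} (\<lambda>w. \<bar>2 * w\<bar> * f (w\<^sup>2)) = Beta (1 - \<alpha> / 2) (p + 1)) \<longleftrightarrow>
      (f absolutely_integrable_on (\<lambda>w. w\<^sup>2) ` {0<..<1} \<and>
       integral ((\<lambda>w. w\<^sup>2) ` {0<..<1}) f = Beta (1 - \<alpha> / 2) (p + 1))"
  proof (rule has_absolute_integral_change_of_variables_1')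
    show "inj_on (\<lambda>w::real. w\<^sup>2) {0<..<1}"
      by (auto simp: inj_on_def power2_eq_iff)
  qed (auto intro!: derivative_eq_intros)
  ultimately have *: "(\<lambda>w. \<bar>2 * w\<bar> * f (w\<^sup>2)) absolutely_integrable_on {0<..<1}"
      "integral {0<..<1} (\<lambda>w. \<bar>2 * w\<bar> * f (w\<^sup>2)) = Beta (1 - \<alpha> / 2) (p + 1)"
    by auto
  have eq: "\<bar>2 * w\<bar> * f (w\<^sup>2) = 2 * beta_density \<alpha> p w" if "w \<in> {0<..<1}" for w
  proof -
    have "(w\<^sup>2) powr (- \<alpha> / 2) = w powr (- \<alpha>)"
      using that by (simp add: powr_powr flip: powr_numeral)
    moreover have "w * w powr (- \<alpha>) = w powr (1 - \<alpha>)"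
      using that by (simp add: powr_mult_base)
    ultimately show ?thesis
      using that by (simp add: f_def beta_density_def)
  qed
  have "(\<lambda>w. 2 * beta_density \<alpha> p w) absolutely_integrable_on {0<..<1}"
    using *(1) eq by (elim absolutely_integrable_spike [OF _ negligible_empty]) auto
  then show "beta_density \<alpha> p absolutely_integrable_on {0<..<1}"
    by (subst (asm) set_integrable_mult_right_iff) auto
  have "integral {0<..<1} (\<lambda>w. 2 * beta_density \<alpha> p w) = Beta (1 - \<alpha> / 2) (p + 1)"
    using *(2) eq by (metis (no_types, lifting) Henstock_Kurzweil_Integration.integral_cong)
  then show "2 * integral {0<..<1} (beta_density \<alpha> p) = Beta (p + 1) (1 - \<alpha> / 2)"
    by (simp add: Beta_commute)
qed

lemma beta_density_absolutely_integrable: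
  assumes "\<alpha> < 2" "p > -1"
  shows "beta_density \<alpha> p absolutely_integrable_on {-1<..<1}"
proof -
  have "beta_density \<alpha> p absolutely_integrable_on uminus ` {0<..<1}"
    using integral_uminus_image [of "{0<..<1}" "beta_density \<alpha> p"] beta_density_integral(1) [OF assms]
    by auto
  \<comment> \<open>The truncation with parameter \<open>0\<close> is the punctured interval.\<close>
  with beta_density_integral(1) [OF assms]
  have "beta_density \<alpha> p absolutely_integrable_on pv_trunc 0 0"
    unfolding pv_trunc_0_eq [OF order_refl] by (intro absolutely_integrable_Un)
  moreover have "{x \<in> pv_trunc 0 0 - {-1<..<1}. beta_density \<alpha> p x \<noteq> 0} \<subseteq> {0}"
    "{x \<in> {-1<..<1} - pv_trunc 0 0. beta_density \<alpha> p x \<noteq> 0} \<subseteq> {0}"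
    by (auto simp: pv_trunc_def)
  then have "negligible {x \<in> pv_trunc 0 0 - {-1<..<1}. beta_density \<alpha> p x \<noteq> 0}"
    "negligible {x \<in> {-1<..<1} - pv_trunc 0 0. beta_density \<alpha> p x \<noteq> 0}"
    by (auto intro: negligible_subset)
  then have "beta_density \<alpha> p absolutely_integrable_on pv_trunc 0 0 \<longleftrightarrow>
      beta_density \<alpha> p absolutely_integrable_on {-1<..<1}"
    by (rule absolutely_integrable_spike_set_eq)
  ultimately show ?thesis
    by simp
qed

text \<open>
  Away from \<open>0\<close> the kernel is a bounded multiple of the beta density, so the behaviour at \<open>\<plusminus>1\<close>, where
  the kernel may be unbounded, is controlled by \<open>p > -1\<close> alone.
\<close>

lemma continuous_times_pv_kernel_integrable:
  assumes "\<alpha> < 2" "p > -1" "\<epsilon> > 0" and h: "continuous_on {-1..1} h"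
  shows "(\<lambda>w. h w * pv_kernel \<alpha> p w) absolutely_integrable_on pv_trunc 0 \<epsilon>"
proof -
  have S: "pv_trunc 0 \<epsilon> \<in> sets lebesgue" "pv_trunc 0 \<epsilon> \<subseteq> {-1..1} \<inter> {w. \<bar>w\<bar> \<ge> \<epsilon>}"
    by (auto simp: pv_trunc_def)
  have K: "compact ({-1..1} \<inter> {w::real. \<bar>w\<bar> \<ge> \<epsilon>})"
    by (intro compact_Int_closed compact_Icc closed_Collect_le continuous_intros)
  have cont: "continuous_on ({-1..1} \<inter> {w. \<bar>w\<bar> \<ge> \<epsilon>}) (\<lambda>w. h w / w\<^sup>2)"
    using assms by (auto intro!: continuous_intros continuous_on_subset [OF h])
  then have "bounded ((\<lambda>w. h w / w\<^sup>2) ` ({-1..1} \<inter> {w. \<bar>w\<bar> \<ge> \<epsilon>}))"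
    using K by (intro compact_imp_bounded compact_continuous_image)
  then have bdd: "bounded ((\<lambda>w. h w / w\<^sup>2) ` pv_trunc 0 \<epsilon>)"
    using S(2) by (meson bounded_subset image_mono)
  have "(\<lambda>w. h w / w\<^sup>2) \<in> borel_measurable (lebesgue_on (pv_trunc 0 \<epsilon>))"
    using S cont by (intro continuous_imp_measurable_on_sets_lebesgue) (auto intro: continuous_on_subset)
  moreover have "beta_density \<alpha> p absolutely_integrable_on pv_trunc 0 \<epsilon>"
    using beta_density_absolutely_integrable [OF assms(1,2)]
    by (rule set_integrable_subset) (auto simp: pv_trunc_def [of _ _])
  ultimately have "(\<lambda>w. h w / w\<^sup>2 * beta_density \<alpha> p w) absolutely_integrable_on pv_trunc 0 \<epsilon>"
    using S bdd by (intro absolutely_integrable_bounded_measurable_product_real)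
  moreover have "h w * pv_kernel \<alpha> p w = h w / w\<^sup>2 * beta_density \<alpha> p w" if "w \<in> pv_trunc 0 \<epsilon>" for w
    using that assms(3) by (auto simp: pv_kernel_eq_beta_density pv_trunc_def)
  ultimately show ?thesis
    by (elim absolutely_integrable_spike [OF _ negligible_empty]) auto
qed

section \<open>Convergence of the principal value I(p)\<close>

lemma one_minus_mult_pos:
  fixes x w :: real
  assumes "\<bar>x\<bar> < 1" "\<bar>w\<bar> \<le> 1"
  shows "0 < 1 - w * x"
proof -
  have "\<bar>w * x\<bar> \<le> 1 * \<bar>x\<bar>"
    unfolding abs_mult using assms(2) by (intro mult_right_mono) auto
  then show ?thesis
    using assms(1) by auto
qed

lemma continuous_on_one_minus_mult_powr:
  fixes x q :: real
  assumes "\<bar>x\<bar> < 1"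
  shows "continuous_on {-1..1} (\<lambda>w. (1 - w * x) powr q)"
proof -
  have "1 - w * x \<noteq> 0" if "w \<in> {-1..1}" for w
    using one_minus_mult_pos [OF assms, of w] that by (simp add: abs_le_iff)
  then show ?thesis
    by (auto intro!: continuous_intros)
qed

text \<open>
  Taylor's theorem to second order: the left-hand side is an even function that vanishes at \<open>0\<close>, so the
  first two Taylor coefficients are zero, and \<open>r < 1\<close> keeps the second derivative bounded.
\<close>

lemma one_minus_powr_symmetric_bound:
  fixes q r :: real
  assumes "r < 1"
  obtains C where "C \<ge> 0" "\<And>t. \<bar>t\<bar> \<le> r \<Longrightarrow> \<bar>(1 - t) powr q + (1 + t) powr q - 2\<bar> \<le> C * t\<^sup>2"
proof -
  define F where "F t = (1 - t) powr q + (1 + t) powr q" for t :: real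
  define F' where "F' t = q * ((1 + t) powr (q - 1) - (1 - t) powr (q - 1))" for t :: real
  define F'' where "F'' t = q * (q - 1) * ((1 + t) powr (q - 2) + (1 - t) powr (q - 2))" for t :: real
  define D where "D n = (if n = 0 then F else if n = 1 then F' else F'')" for n :: nat
  have F': "(F has_real_derivative F' t) (at t)" if "\<bar>t\<bar> \<le> r" for t
    unfolding F_def F'_def using that assms
    by (auto intro!: derivative_eq_intros simp: right_diff_distrib)
  have F'': "(F' has_real_derivative F'' t) (at t)" if "\<bar>t\<bar> \<le> r" for t
    unfolding F'_def F''_def using that assms
    by (auto intro!: derivative_eq_intros simp: algebra_simps)
  have deriv: "\<forall>m s. m < 2 \<and> \<bar>s\<bar> \<le> \<bar>t\<bar> \<longrightarrow> (D m has_real_derivative D (Suc m) s) (at s)"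
    if "\<bar>t\<bar> \<le> r" for t
    using F' F'' that by (auto simp: D_def less_2_cases_iff)
  have "continuous_on {-r..r} F''"
    using assms unfolding F''_def by (auto intro!: continuous_intros)
  then have "bounded (F'' ` {-r..r})"
    by (intro compact_imp_bounded compact_continuous_image compact_Icc)
  then obtain B where B: "\<forall>t\<in>{-r..r}. \<bar>F'' t\<bar> \<le> B"
    by (auto simp: bounded_iff)
  show ?thesis
  proof
    show "max B 0 \<ge> 0" by simp
    fix t :: real assume t: "\<bar>t\<bar> \<le> r"
    obtain s where s: "\<bar>s\<bar> \<le> \<bar>t\<bar>"
      "F t = (\<Sum>m<2. D m 0 / fact m * t ^ m) + D 2 s / fact 2 * t\<^sup>2"
      using Maclaurin_bi_le [OF _ deriv [OF t], of F] by (auto simp: D_def)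
    have "F 0 = 2" "F' 0 = 0"
      by (simp_all add: F_def F'_def)
    then have "(1 - t) powr q + (1 + t) powr q - 2 = F'' s / 2 * t\<^sup>2"
      using s(2) by (simp add: D_def F_def numeral_2_eq_2)
    moreover have "\<bar>F'' s / 2\<bar> \<le> max B 0"
    proof -
      have "\<bar>F'' s\<bar> \<le> B"
        using s(1) t by (intro B [rule_format]) (simp add: abs_le_iff; linarith)
      then show ?thesis
        unfolding abs_divide by auto
    qed
    ultimately show "\<bar>(1 - t) powr q + (1 + t) powr q - 2\<bar> \<le> max B 0 * t\<^sup>2"
      by (metis abs_mult abs_power2 mult_right_mono zero_le_power2)
  qed
qed

lemma I_integrand_eq: "I_integrand \<alpha> x p w = ((1 - w * x) powr (\<alpha> - 1 - 2 * p) - 1) * pv_kernel \<alpha> p w"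
  by (simp add: I_integrand_def pv_kernel_def)

lemma I_integrand_integrable:
  assumes "\<alpha> < 2" "p > -1" "\<bar>x\<bar> < 1" "\<epsilon> > 0"
  shows "I_integrand \<alpha> x p absolutely_integrable_on pv_trunc 0 \<epsilon>"
  unfolding I_integrand_eq [abs_def] using assms
  by (intro continuous_times_pv_kernel_integrable continuous_intros continuous_on_one_minus_mult_powr)

lemma integral_I_integrand_fold:
  assumes "\<alpha> < 2" "p > -1" "\<bar>x\<bar> < 1" "\<epsilon> > 0"
  shows "(LINT w:pv_trunc 0 \<epsilon>|lebesgue. I_integrand \<alpha> x p w) =
    integral {\<epsilon><..<1} (\<lambda>w. ((1 - w * x) powr (\<alpha> - 1 - 2 * p) + (1 + w * x) powr (\<alpha> - 1 - 2 * p) - 2)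
      * pv_kernel \<alpha> p w)"
proof -
  have "(LINT w:pv_trunc 0 \<epsilon>|lebesgue. I_integrand \<alpha> x p w) =
      integral {\<epsilon><..<1} (\<lambda>w. I_integrand \<alpha> x p w + I_integrand \<alpha> x p (- w))"
    using assms by (intro integral_pv_trunc_fold I_integrand_integrable) auto
  also have "\<dots> = integral {\<epsilon><..<1} (\<lambda>w. ((1 - w * x) powr (\<alpha> - 1 - 2 * p) + (1 + w * x) powr (\<alpha> - 1 - 2 * p) - 2)
      * pv_kernel \<alpha> p w)"
    by (intro Henstock_Kurzweil_Integration.integral_cong) (simp add: I_integrand_eq algebra_simps)
  finally show ?thesis .
qed

text \<open>
  After folding, the numerator is a second difference of size \<open>O(w\<^sup>2)\<close>, which absorbs two powers of the
  kernel: the folded integrand is dominated by the beta density and so is absolutely integrable up to \<open>0\<close>.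
\<close>

lemma I_integrand_tendsto:
  assumes "\<alpha> < 2" "p > -1" "\<bar>x\<bar> < 1"
  obtains l where "((\<lambda>\<epsilon>. LINT w:pv_trunc 0 \<epsilon>|lebesgue. I_integrand \<alpha> x p w) \<longlongrightarrow> l) (at_right 0)"
proof -
  define q where "q = \<alpha> - 1 - 2 * p"
  define g where "g w = (1 - w * x) powr q + (1 + w * x) powr q - 2" for w
  obtain C where C: "C \<ge> 0" "\<And>t. \<bar>t\<bar> \<le> \<bar>x\<bar> \<Longrightarrow> \<bar>(1 - t) powr q + (1 + t) powr q - 2\<bar> \<le> C * t\<^sup>2"
    using one_minus_powr_symmetric_bound assms(3) by blast
  have bound: "\<bar>g w * pv_kernel \<alpha> p w\<bar> \<le> C * beta_density \<alpha> p w" if "w \<in> {0<..<1}" for w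
  proof -
    have "\<bar>w * x\<bar> \<le> \<bar>x\<bar>"
      using that by (simp add: abs_mult mult_left_le_one_le)
    then have "\<bar>g w\<bar> \<le> C * (w * x)\<^sup>2"
      using C(2) unfolding g_def by blast
    also have "\<dots> \<le> C * w\<^sup>2"
      using \<open>\<bar>x\<bar> < 1\<close> C(1) by (auto intro!: mult_left_mono simp: power_mult_distrib mult_left_le abs_square_le_1)
    finally have "\<bar>g w\<bar> * beta_density \<alpha> p w / w\<^sup>2 \<le> C * w\<^sup>2 * beta_density \<alpha> p w / w\<^sup>2"
      by (intro divide_right_mono mult_right_mono) (auto simp: beta_density_def)
    moreover have "beta_density \<alpha> p w \<ge> 0"
      by (simp add: beta_density_def)
    ultimately show ?thesis
      using that by (simp add: pv_kernel_eq_beta_density abs_mult)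
  qed
  have cont: "continuous_on {0<..<1} (\<lambda>w. g w * pv_kernel \<alpha> p w)"
  proof -
    have "1 - w\<^sup>2 \<noteq> 0" if "w \<in> {0<..<1}" for w :: real
      using that by (auto simp: power2_eq_1_iff)
    then have "continuous_on {0<..<1} (pv_kernel \<alpha> p)"
      unfolding pv_kernel_def [abs_def] by (auto intro!: continuous_intros)
    moreover have "continuous_on {0<..<1} g"
    proof -
      have "continuous_on {0<..<1} (\<lambda>w. (1 - w * x) powr q)" "continuous_on {0<..<1} (\<lambda>w. (1 - w * (- x)) powr q)"
        using continuous_on_one_minus_mult_powr [of x q] continuous_on_one_minus_mult_powr [of "- x" q] assms(3)
        by (auto elim!: continuous_on_subset)
      then show ?thesis
        unfolding g_def [abs_def] by (auto intro!: continuous_intros)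
    qed
    ultimately show ?thesis
      by (intro continuous_intros)
  qed
  have "(\<lambda>w. g w * pv_kernel \<alpha> p w) absolutely_integrable_on {0<..<1}"
  proof (rule measurable_bounded_by_integrable_imp_absolutely_integrable)
    show "(\<lambda>w. g w * pv_kernel \<alpha> p w) \<in> borel_measurable (lebesgue_on {0<..<1})"
      using cont by (rule continuous_imp_measurable_on_sets_lebesgue) auto
    show "(\<lambda>w. C * beta_density \<alpha> p w) integrable_on {0<..<1}"
      using beta_density_integral(1) [OF assms(1,2)]
      by (intro integrable_on_mult_right set_lebesgue_integral_eq_integral(1))
  qed (use bound in auto)
  then have "(\<lambda>w. g w * pv_kernel \<alpha> p w) integrable_on {0<..<1}"
    by (rule set_lebesgue_integral_eq_integral)
  from integral_truncate_left_tendsto [OF this]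
  have "((\<lambda>\<epsilon>. LINT w:pv_trunc 0 \<epsilon>|lebesgue. I_integrand \<alpha> x p w)
      \<longlongrightarrow> integral {0<..<1} (\<lambda>w. g w * pv_kernel \<alpha> p w)) (at_right 0)"
    by (rule Lim_transform_eventually)
      (auto intro!: eventually_at_rightI [of 0 1] simp: integral_I_integrand_fold assms g_def q_def)
  then show ?thesis
    by (rule that)
qed

lemma I_pv_tendsto:
  assumes "\<alpha> < 2" "p > -1" "\<bar>x\<bar> < 1"
  shows "((\<lambda>\<epsilon>. LINT w:pv_trunc 0 \<epsilon>|lebesgue. I_integrand \<alpha> x p w) \<longlongrightarrow> I_pv \<alpha> x p) (at_right 0)"
  unfolding I_pv_def using I_integrand_tendsto [OF assms] pv_integralI by metis

lemma pv_convergent_I_integrand: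
  assumes "\<alpha> < 2" "p > -1" "\<bar>x\<bar> < 1"
  shows "pv_convergent 0 (I_integrand \<alpha> x p)"
  unfolding pv_convergent_def using I_integrand_integrable I_pv_tendsto assms by blast

section \<open>The explicitly integrable part\<close>

text \<open>
  The primitive \<open>w\<^bsup>-\<alpha>\<^esup> (1 - w\<^sup>2)\<^bsup>p + 1\<^esup>\<close> has the exponent \<open>p + 1 > 0\<close>, rather than \<open>p\<close>, so that it is
  continuous and vanishes at \<open>w = 1\<close> even when \<open>p < 0\<close>.  Its derivative exchanges the kernel for the beta
  density, which stays integrable at \<open>0\<close>.
\<close>

lemma integral_pv_kernel:
  assumes "\<alpha> < 2" "p > -1" "0 < \<delta>" "\<delta> < 1"
  shows "pv_kernel \<alpha> p integrable_on {\<delta><..<1}"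
    and "\<alpha> * integral {\<delta><..<1} (pv_kernel \<alpha> p) =
      \<delta> powr (- \<alpha>) * (1 - \<delta>\<^sup>2) powr (p + 1) - (2 * p + 2 - \<alpha>) * integral {\<delta><..<1} (beta_density \<alpha> p)"
proof -
  define F where "F w = w powr (- \<alpha>) * (1 - w\<^sup>2) powr (p + 1)" for w
  have sub: "{\<delta><..<1} \<subseteq> pv_trunc 0 \<delta>"
    using assms by (auto simp: pv_trunc_def)
  have "(\<lambda>w. 1 * pv_kernel \<alpha> p w) absolutely_integrable_on {\<delta><..<1}"
    using assms sub by (intro set_integrable_subset [OF continuous_times_pv_kernel_integrable]) auto
  then show int1: "pv_kernel \<alpha> p integrable_on {\<delta><..<1}"
    using set_lebesgue_integral_eq_integral(1) by auto
  have "beta_density \<alpha> p absolutely_integrable_on {\<delta><..<1}"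
    using assms by (intro set_integrable_subset [OF beta_density_integral(1)]) auto
  then have int2: "beta_density \<alpha> p integrable_on {\<delta><..<1}"
    by (rule set_lebesgue_integral_eq_integral)
  have "((\<lambda>w. - \<alpha> * pv_kernel \<alpha> p w - (2 * p + 2 - \<alpha>) * beta_density \<alpha> p w) has_integral (F 1 - F \<delta>)) {\<delta>..1}"
  proof (rule fundamental_theorem_of_calculus_interior)
    have "1 - w\<^sup>2 \<ge> 0" if "w \<in> {\<delta>..1}" for w :: real
      using that assms by (auto simp: power_le_one)
    then show "continuous_on {\<delta>..1} F"
      using assms unfolding F_def [abs_def] by (auto intro!: continuous_intros continuous_on_powr')
    fix w assume w: "w \<in> {\<delta><..<1}"
    have pos: "1 - w\<^sup>2 > 0" "w > 0"
      using w assms by (auto simp: power_less_one_iff)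
    have "(F has_real_derivative (- \<alpha> * w powr (- \<alpha> - 1) * (1 - w\<^sup>2) powr (p + 1)
        + w powr (- \<alpha>) * ((p + 1) * (1 - w\<^sup>2) powr p * (- 2 * w)))) (at w)"
      unfolding F_def using pos by (auto intro!: derivative_eq_intros)
    also have "- \<alpha> * w powr (- \<alpha> - 1) * (1 - w\<^sup>2) powr (p + 1)
        + w powr (- \<alpha>) * ((p + 1) * (1 - w\<^sup>2) powr p * (- 2 * w)) =
        - \<alpha> * pv_kernel \<alpha> p w - (2 * p + 2 - \<alpha>) * beta_density \<alpha> p w"
    proof -
      have 1: "(1 - w\<^sup>2) powr (p + 1) = (1 - w\<^sup>2) * (1 - w\<^sup>2) powr p"
        using pos by (simp add: powr_add)
      have 2: "w powr (- \<alpha>) = w * w powr (- \<alpha> - 1)"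
        using pos by (simp add: powr_mult_base)
      have 3: "beta_density \<alpha> p w = w\<^sup>2 * w powr (- \<alpha> - 1) * (1 - w\<^sup>2) powr p"
        using pos powr_add [of w 2 "- \<alpha> - 1"] by (simp add: beta_density_def)
      have 4: "pv_kernel \<alpha> p w = w powr (- \<alpha> - 1) * (1 - w\<^sup>2) powr p"
        using pos by (simp add: pv_kernel_eq_beta_density 3)
      show ?thesis
        unfolding 1 2 3 4 by (simp add: algebra_simps power2_eq_square)
    qed
    finally show "(F has_vector_derivative (- \<alpha> * pv_kernel \<alpha> p w - (2 * p + 2 - \<alpha>) * beta_density \<alpha> p w)) (at w)"
      by (simp add: has_real_derivative_iff_has_vector_derivative)
  qed (use assms in auto)
  then have "integral {\<delta><..<1} (\<lambda>w. - \<alpha> * pv_kernel \<alpha> p w - (2 * p + 2 - \<alpha>) * beta_density \<alpha> p w) = F 1 - F \<delta>"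
    by (simp only: has_integral_Icc_iff_Ioo integral_unique)
  moreover have "integral {\<delta><..<1} (\<lambda>w. - \<alpha> * pv_kernel \<alpha> p w - (2 * p + 2 - \<alpha>) * beta_density \<alpha> p w) =
      - \<alpha> * integral {\<delta><..<1} (pv_kernel \<alpha> p) - (2 * p + 2 - \<alpha>) * integral {\<delta><..<1} (beta_density \<alpha> p)"
    by (subst Henstock_Kurzweil_Integration.integral_diff)
       (use integrable_on_mult_right [OF int1, of "- \<alpha>"] integrable_on_mult_right [OF int2, of "2 * p + 2 - \<alpha>"] in auto)
  ultimately show "\<alpha> * integral {\<delta><..<1} (pv_kernel \<alpha> p) =
      \<delta> powr (- \<alpha>) * (1 - \<delta>\<^sup>2) powr (p + 1) - (2 * p + 2 - \<alpha>) * integral {\<delta><..<1} (beta_density \<alpha> p)"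
    by (simp add: F_def)
qed

text \<open>
  The part of the transformed integrand that comes from the subtracted constant \<open>u\<^sub>p(x)\<close>.  Up to
  a constant factor its primitive is \<open>((1 - w x) / w)\<^bsup>\<alpha>\<^esup>\<close>, because the derivative of \<open>(1 - w x) / w\<close> is \<open>- 1 / w\<^sup>2\<close>.
\<close>

lemma integral_one_minus_powr_kernel:
  assumes "\<alpha> < 2" "\<bar>x\<bar> < 1" "0 < \<delta>" "\<delta> < 1"
  shows "(\<lambda>w. (1 - w * x) powr (\<alpha> - 1) * pv_kernel \<alpha> 0 w) integrable_on {\<delta><..<1}"
    and "\<alpha> * integral {\<delta><..<1} (\<lambda>w. (1 - w * x) powr (\<alpha> - 1) * pv_kernel \<alpha> 0 w) =
      \<delta> powr (- \<alpha>) * (1 - \<delta> * x) powr \<alpha> - (1 - x) powr \<alpha>"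
proof -
  define F where "F w = w powr (- \<alpha>) * (1 - w * x) powr \<alpha>" for w
  let ?f = "\<lambda>w. (1 - w * x) powr (\<alpha> - 1) * pv_kernel \<alpha> 0 w"
  have "?f absolutely_integrable_on {\<delta><..<1}"
    using assms by (intro set_integrable_subset [OF continuous_times_pv_kernel_integrable]
      continuous_on_one_minus_mult_powr) (auto simp: pv_trunc_def)
  then show int: "?f integrable_on {\<delta><..<1}"
    by (rule set_lebesgue_integral_eq_integral)
  have pos: "1 - w * x > 0" if "w \<in> {\<delta>..1}" for w
    using that assms by (intro one_minus_mult_pos) auto
  have "((\<lambda>w. - \<alpha> * ?f w) has_integral (F 1 - F \<delta>)) {\<delta>..1}"
  proof (rule fundamental_theorem_of_calculus_interior)
    show "continuous_on {\<delta>..1} F"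
      using assms pos unfolding F_def [abs_def] by (force intro!: continuous_intros)
    fix w assume w: "w \<in> {\<delta><..<1}"
    have pos: "1 - w * x > 0" "w > 0" "1 - w\<^sup>2 > 0"
      using w assms pos by (auto simp: power_less_one_iff)
    have "(F has_real_derivative (- \<alpha> * w powr (- \<alpha> - 1) * (1 - w * x) powr \<alpha>
        + w powr (- \<alpha>) * (\<alpha> * (1 - w * x) powr (\<alpha> - 1) * (- x)))) (at w)"
      unfolding F_def using pos by (auto intro!: derivative_eq_intros)
    also have "- \<alpha> * w powr (- \<alpha> - 1) * (1 - w * x) powr \<alpha>
        + w powr (- \<alpha>) * (\<alpha> * (1 - w * x) powr (\<alpha> - 1) * (- x)) = - \<alpha> * ?f w"
    proof -
      have 1: "(1 - w * x) powr \<alpha> = (1 - w * x) * (1 - w * x) powr (\<alpha> - 1)"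
        using pos by (simp add: powr_mult_base)
      have 2: "w powr (- \<alpha>) = w * w powr (- \<alpha> - 1)"
        using pos by (simp add: powr_mult_base)
      have 3: "pv_kernel \<alpha> 0 w = w powr (- \<alpha> - 1)"
      proof -
        have "- \<alpha> - 1 = - (1 + \<alpha>)" by simp
        then show ?thesis
          using pos by (simp only: powr_minus_divide) (simp add: pv_kernel_def)
      qed
      show ?thesis
        unfolding 1 2 3 by (simp add: algebra_simps)
    qed
    finally show "(F has_vector_derivative - \<alpha> * ?f w) (at w)"
      by (simp add: has_real_derivative_iff_has_vector_derivative)
  qed (use assms in auto)
  then have "integral {\<delta><..<1} (\<lambda>w. - \<alpha> * ?f w) = F 1 - F \<delta>"
    by (simp only: has_integral_Icc_iff_Ioo integral_unique)
  moreover have "integral {\<delta><..<1} (\<lambda>w. - \<alpha> * ?f w) = - \<alpha> * integral {\<delta><..<1} ?f"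
    by (rule integral_mult_right)
  ultimately show "\<alpha> * integral {\<delta><..<1} ?f = \<delta> powr (- \<alpha>) * (1 - \<delta> * x) powr \<alpha> - (1 - x) powr \<alpha>"
    by (simp add: F_def)
qed

text \<open>
  The bracket collects the boundary terms at \<open>|w| = \<delta>\<close> of the two primitives.  It is \<open>O(\<delta>\<^sup>2)\<close>: the
  constants cancel, the first summand depends on \<open>\<delta>\<^sup>2\<close> only, and the other two form a symmetric sum
  without a linear term.
\<close>

lemma boundary_terms_tendsto_0:
  fixes \<alpha> p x :: real
  assumes "\<alpha> < 2" "\<bar>x\<bar> < 1"
  shows "((\<lambda>\<delta>. \<delta> powr (- \<alpha>) * (2 * (1 - \<delta>\<^sup>2) powr (p + 1)
    - ((1 - \<delta> * x) powr \<alpha> + (1 + \<delta> * x) powr \<alpha>))) \<longlongrightarrow> 0) (at_right 0)"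
proof -
  have null: "((\<lambda>\<delta>. \<delta> powr (2 - \<alpha>)) \<longlongrightarrow> 0) (at_right (0::real))"
    using assms by (intro tendsto_eq_intros) (auto intro!: eventually_at_rightI [of 0 1])
  have "((\<lambda>s. (1 - s) powr (p + 1)) has_real_derivative - (p + 1)) (at 0)"
    by (auto intro!: derivative_eq_intros)
  then have "((\<lambda>s. ((1 - s) powr (p + 1) - 1) / s) \<longlongrightarrow> - (p + 1)) (at 0)"
    by (simp add: DERIV_def)
  moreover have "filterlim (\<lambda>\<delta>::real. \<delta>\<^sup>2) (at 0) (at_right 0)"
    unfolding filterlim_at by (auto intro!: tendsto_eq_intros eventually_at_rightI [of 0 1])
  ultimately have "((\<lambda>\<delta>. ((1 - \<delta>\<^sup>2) powr (p + 1) - 1) / \<delta>\<^sup>2) \<longlongrightarrow> - (p + 1)) (at_right 0)"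
    by (rule filterlim_compose)
  from tendsto_mult [OF null this]
  have "((\<lambda>\<delta>. \<delta> powr (2 - \<alpha>) * (((1 - \<delta>\<^sup>2) powr (p + 1) - 1) / \<delta>\<^sup>2)) \<longlongrightarrow> 0) (at_right 0)"
    by simp
  then have 1: "((\<lambda>\<delta>. 2 * (\<delta> powr (2 - \<alpha>) * (((1 - \<delta>\<^sup>2) powr (p + 1) - 1) / \<delta>\<^sup>2))) \<longlongrightarrow> 0) (at_right 0)"
    by (rule tendsto_mult_right_zero)
  obtain C where C: "C \<ge> 0" "\<And>t. \<bar>t\<bar> \<le> \<bar>x\<bar> \<Longrightarrow> \<bar>(1 - t) powr \<alpha> + (1 + t) powr \<alpha> - 2\<bar> \<le> C * t\<^sup>2"
    using one_minus_powr_symmetric_bound assms(2) by blast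
  have pow: "\<delta> powr (2 - \<alpha>) = \<delta>\<^sup>2 * \<delta> powr (- \<alpha>)" if "\<delta> > 0" for \<delta> :: real
    using powr_add [of \<delta> 2 "- \<alpha>"] that by simp
  have 2: "((\<lambda>\<delta>. \<delta> powr (- \<alpha>) * ((1 - \<delta> * x) powr \<alpha> + (1 + \<delta> * x) powr \<alpha> - 2)) \<longlongrightarrow> 0) (at_right 0)"
  proof (rule Lim_null_comparison)
    show "((\<lambda>\<delta>. C * \<delta> powr (2 - \<alpha>)) \<longlongrightarrow> 0) (at_right 0)"
      using null by (rule tendsto_mult_right_zero)
    show "\<forall>\<^sub>F \<delta> in at_right 0. norm (\<delta> powr (- \<alpha>) * ((1 - \<delta> * x) powr \<alpha> + (1 + \<delta> * x) powr \<alpha> - 2))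
        \<le> C * \<delta> powr (2 - \<alpha>)"
    proof (rule eventually_at_rightI [of 0 1])
      fix \<delta> :: real assume \<delta>: "\<delta> \<in> {0<..<1}"
      have "\<bar>\<delta> * x\<bar> \<le> \<bar>x\<bar>"
        using \<delta> by (simp add: abs_mult mult_left_le_one_le)
      then have "\<bar>(1 - \<delta> * x) powr \<alpha> + (1 + \<delta> * x) powr \<alpha> - 2\<bar> \<le> C * (\<delta> * x)\<^sup>2"
        by (rule C(2))
      also have "\<dots> \<le> C * \<delta>\<^sup>2"
        using \<open>\<bar>x\<bar> < 1\<close> C(1) by (auto intro!: mult_left_mono simp: power_mult_distrib mult_left_le abs_square_le_1)
      finally have "\<delta> powr (- \<alpha>) * \<bar>(1 - \<delta> * x) powr \<alpha> + (1 + \<delta> * x) powr \<alpha> - 2\<bar> \<le> \<delta> powr (- \<alpha>) * (C * \<delta>\<^sup>2)"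
        by (intro mult_left_mono) auto
      then show "norm (\<delta> powr (- \<alpha>) * ((1 - \<delta> * x) powr \<alpha> + (1 + \<delta> * x) powr \<alpha> - 2)) \<le> C * \<delta> powr (2 - \<alpha>)"
        using \<delta> by (simp add: abs_mult pow mult_ac)
    qed auto
  qed
  have "((\<lambda>\<delta>. 2 * (\<delta> powr (2 - \<alpha>) * (((1 - \<delta>\<^sup>2) powr (p + 1) - 1) / \<delta>\<^sup>2)) -
      \<delta> powr (- \<alpha>) * ((1 - \<delta> * x) powr \<alpha> + (1 + \<delta> * x) powr \<alpha> - 2)) \<longlongrightarrow> 0) (at_right 0)"
    using tendsto_diff [OF 1 2] by simp
  moreover have eq: "\<delta> powr (2 - \<alpha>) * (((1 - \<delta>\<^sup>2) powr (p + 1) - 1) / \<delta>\<^sup>2) =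
      \<delta> powr (- \<alpha>) * ((1 - \<delta>\<^sup>2) powr (p + 1) - 1)" if "\<delta> > 0" for \<delta>
    using that by (simp add: pow)
  ultimately show ?thesis
    by (elim Lim_transform_eventually)
      (rule eventually_at_rightI [of 0 1], simp only: eq greaterThanLessThan_iff, simp_all add: algebra_simps)
qed

lemma pv_kernel_difference_integrable:
  assumes "\<alpha> < 2" "p > -1" "\<bar>x\<bar> < 1" "\<epsilon> > 0"
  shows "(\<lambda>w. pv_kernel \<alpha> p w - (1 - w * x) powr (\<alpha> - 1) * pv_kernel \<alpha> 0 w) absolutely_integrable_on pv_trunc 0 \<epsilon>"
proof -
  have "(\<lambda>w. 1 * pv_kernel \<alpha> p w) absolutely_integrable_on pv_trunc 0 \<epsilon>"
    "(\<lambda>w. (1 - w * x) powr (\<alpha> - 1) * pv_kernel \<alpha> 0 w) absolutely_integrable_on pv_trunc 0 \<epsilon>"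
    using assms by (intro continuous_times_pv_kernel_integrable continuous_on_one_minus_mult_powr; auto)+
  then show ?thesis
    by (auto intro: set_integral_diff(1))
qed

text \<open>
  Each kernel alone has a divergent principal value; only their difference converges.  The boundary terms
  at \<open>|w| = 1\<close> give the powers of \<open>1 - x\<close> and \<open>1 + x\<close>, those at \<open>|w| = \<delta>\<close> vanish in the limit.
\<close>

lemma pv_kernel_difference_tendsto:
  assumes "0 < \<alpha>" "\<alpha> < 2" "p > -1" "\<bar>x\<bar> < 1"
  shows "((\<lambda>\<delta>. LINT w:pv_trunc 0 \<delta>|lebesgue. pv_kernel \<alpha> p w - (1 - w * x) powr (\<alpha> - 1) * pv_kernel \<alpha> 0 w)
    \<longlongrightarrow> ((1 - x) powr \<alpha> + (1 + x) powr \<alpha> - (2 * p + 2 - \<alpha>) * Beta (p + 1) (1 - \<alpha> / 2)) / \<alpha>) (at_right 0)"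
proof -
  let ?c = "2 * p + 2 - \<alpha>"
  let ?k = "\<lambda>x w. (1 - w * x) powr (\<alpha> - 1) * pv_kernel \<alpha> 0 w"
  have eq: "((\<delta> powr (- \<alpha>) * (2 * (1 - \<delta>\<^sup>2) powr (p + 1) - ((1 - \<delta> * x) powr \<alpha> + (1 + \<delta> * x) powr \<alpha>)))
        + (1 - x) powr \<alpha> + (1 + x) powr \<alpha> - ?c * (2 * integral {\<delta><..<1} (beta_density \<alpha> p))) / \<alpha> =
      (LINT w:pv_trunc 0 \<delta>|lebesgue. pv_kernel \<alpha> p w - ?k x w)" if "0 < \<delta>" "\<delta> < 1" for \<delta>
  proof -
    note int = integral_pv_kernel [OF assms(2,3) that] integral_one_minus_powr_kernel [OF assms(2,4) that]
      integral_one_minus_powr_kernel [OF assms(2) _ that, of "- x"]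
    have "(LINT w:pv_trunc 0 \<delta>|lebesgue. pv_kernel \<alpha> p w - ?k x w) =
        integral {\<delta><..<1} (\<lambda>w. (pv_kernel \<alpha> p w - ?k x w) + (pv_kernel \<alpha> p (- w) - ?k x (- w)))"
      using assms that by (intro integral_pv_trunc_fold pv_kernel_difference_integrable) auto
    also have "\<dots> = integral {\<delta><..<1} (\<lambda>w. (pv_kernel \<alpha> p w - ?k x w) + (pv_kernel \<alpha> p w - ?k (- x) w))"
      by simp
    also have "\<dots> = (integral {\<delta><..<1} (pv_kernel \<alpha> p) - integral {\<delta><..<1} (?k x))
        + (integral {\<delta><..<1} (pv_kernel \<alpha> p) - integral {\<delta><..<1} (?k (- x)))"
      using int(1,3,5) assms(4)
      by (subst Henstock_Kurzweil_Integration.integral_add)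
         (auto intro: Henstock_Kurzweil_Integration.integrable_diff
          simp: Henstock_Kurzweil_Integration.integral_diff)
    also have "\<dots> = (2 * (\<alpha> * integral {\<delta><..<1} (pv_kernel \<alpha> p)) - \<alpha> * integral {\<delta><..<1} (?k x)
        - \<alpha> * integral {\<delta><..<1} (?k (- x))) / \<alpha>"
      using assms(1) by (simp add: field_simps)
    also have "\<dots> = (2 * (\<delta> powr (- \<alpha>) * (1 - \<delta>\<^sup>2) powr (p + 1) - ?c * integral {\<delta><..<1} (beta_density \<alpha> p))
        - (\<delta> powr (- \<alpha>) * (1 - \<delta> * x) powr \<alpha> - (1 - x) powr \<alpha>)
        - (\<delta> powr (- \<alpha>) * (1 - \<delta> * (- x)) powr \<alpha> - (1 - (- x)) powr \<alpha>)) / \<alpha>"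
      using int(2,4,6) assms(4) by simp
    finally show ?thesis
      by (simp add: algebra_simps)
  qed
  have "((\<lambda>\<delta>. 2 * integral {\<delta><..<1} (beta_density \<alpha> p)) \<longlongrightarrow> Beta (p + 1) (1 - \<alpha> / 2)) (at_right 0)"
    unfolding beta_density_integral(2) [OF assms(2,3), symmetric]
    using beta_density_integral(1) [OF assms(2,3)]
    by (intro tendsto_mult tendsto_const integral_truncate_left_tendsto set_lebesgue_integral_eq_integral(1))
  then have "((\<lambda>\<delta>. ((\<delta> powr (- \<alpha>) * (2 * (1 - \<delta>\<^sup>2) powr (p + 1) - ((1 - \<delta> * x) powr \<alpha> + (1 + \<delta> * x) powr \<alpha>)))
        + (1 - x) powr \<alpha> + (1 + x) powr \<alpha> - ?c * (2 * integral {\<delta><..<1} (beta_density \<alpha> p))) / \<alpha>)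
      \<longlongrightarrow> (0 + (1 - x) powr \<alpha> + (1 + x) powr \<alpha> - ?c * Beta (p + 1) (1 - \<alpha> / 2)) / \<alpha>) (at_right 0)"
    using assms by (intro tendsto_intros boundary_terms_tendsto_0) auto
  then show ?thesis
    unfolding add_0_left
    by (rule Lim_transform_eventually) (auto intro!: eventually_at_rightI [of 0 1] eq)
qed

section \<open>The Moebius substitution\<close>

text \<open>
  The numerator \<open>x - w\<close>, rather than \<open>w - x\<close>, makes the map an involution, so that injectivity and the
  image of a set come from one identity.
\<close>

definition moebius :: "real \<Rightarrow> real \<Rightarrow> real" where
  "moebius x w = (x - w) / (1 - w * x)"

lemma one_minus_moebius_square:
  assumes "\<bar>x\<bar> < 1" "\<bar>w\<bar> < 1"
  shows "1 - (moebius x w)\<^sup>2 = (1 - x\<^sup>2) * (1 - w\<^sup>2) / (1 - w * x)\<^sup>2"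
  using one_minus_mult_pos [OF assms(1) less_imp_le [OF assms(2)]]
  by (simp add: moebius_def power_divide field_simps) (simp add: power2_eq_square algebra_simps)

lemma diff_moebius:
  assumes "\<bar>x\<bar> < 1" "\<bar>w\<bar> < 1"
  shows "x - moebius x w = w * (1 - x\<^sup>2) / (1 - w * x)"
  using one_minus_mult_pos [OF assms(1) less_imp_le [OF assms(2)]]
  by (simp add: moebius_def field_simps power2_eq_square)

lemma abs_moebius_less_1:
  assumes "\<bar>x\<bar> < 1" "\<bar>w\<bar> < 1"
  shows "\<bar>moebius x w\<bar> < 1"
proof -
  have "0 < 1 - (moebius x w)\<^sup>2"
    unfolding one_minus_moebius_square [OF assms] using assms one_minus_mult_pos [OF assms(1) less_imp_le [OF assms(2)]]
    by (intro divide_pos_pos mult_pos_pos) (auto simp: abs_square_less_1)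
  then show ?thesis
    by (simp add: abs_square_less_1)
qed

lemma moebius_moebius:
  assumes "\<bar>x\<bar> < 1" "\<bar>w\<bar> < 1"
  shows "moebius x (moebius x w) = w"
proof -
  have pos: "1 - w * x > 0" "1 - x\<^sup>2 > 0"
    using one_minus_mult_pos [OF assms(1) less_imp_le [OF assms(2)]] assms by (auto simp: abs_square_less_1)
  have "1 - moebius x w * x = (1 - x\<^sup>2) / (1 - w * x)"
    using pos by (simp add: moebius_def field_simps power2_eq_square)
  moreover have "moebius x (moebius x w) = (x - moebius x w) / (1 - moebius x w * x)"
    by (rule moebius_def)
  ultimately show ?thesis
    using pos by (simp add: diff_moebius [OF assms])
qed

lemma moebius_has_derivative:
  assumes "\<bar>x\<bar> < 1" "\<bar>w\<bar> < 1"
  shows "(moebius x has_real_derivative - ((1 - x\<^sup>2) / (1 - w * x)\<^sup>2)) (at w within S)"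
proof -
  have "(moebius x has_real_derivative
      ((- 1) * (1 - w * x) - (x - w) * (- x)) / ((1 - w * x) * (1 - w * x))) (at w within S)"
    unfolding moebius_def [abs_def] using one_minus_mult_pos [OF assms(1) less_imp_le [OF assms(2)]]
    by (auto intro!: derivative_eq_intros)
  moreover have "(- 1) * (1 - w * x) - (x - w) * (- x) = - (1 - x\<^sup>2)"
    by (simp add: algebra_simps power2_eq_square)
  ultimately show ?thesis
    by (simp only: power2_eq_square minus_divide_left)
qed

text \<open>
  The inequality is \<open>|x - moebius x w| > \<epsilon>\<close> with the denominator \<open>1 - w x\<close> cleared.
\<close>

definition moebius_trunc :: "real \<Rightarrow> real \<Rightarrow> real set" where
  "moebius_trunc x \<epsilon> = {-1<..<1} \<inter> {w. \<epsilon> * (1 - w * x) < \<bar>w\<bar> * (1 - x\<^sup>2)}"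

lemma sets_moebius_trunc [simp]: "moebius_trunc x \<epsilon> \<in> sets lebesgue"
proof -
  have "open {w. \<epsilon> * (1 - w * x) < \<bar>w\<bar> * (1 - x\<^sup>2)}"
    by (intro open_Collect_less continuous_intros)
  then have "open (moebius_trunc x \<epsilon>)"
    by (auto simp: moebius_trunc_def)
  then show ?thesis by auto
qed

lemma moebius_image_trunc:
  assumes "\<bar>x\<bar> < 1"
  shows "moebius x ` moebius_trunc x \<epsilon> = pv_trunc x \<epsilon>"
proof -
  have iff: "moebius x w \<in> pv_trunc x \<epsilon> \<longleftrightarrow> w \<in> moebius_trunc x \<epsilon>" if w: "\<bar>w\<bar> < 1" for w
  proof -
    note pos = one_minus_mult_pos [OF assms less_imp_le [OF w]]
    have "1 - x\<^sup>2 > 0"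
      using assms by (simp add: abs_square_less_1)
    then have "\<bar>moebius x w - x\<bar> = \<bar>w\<bar> * (1 - x\<^sup>2) / (1 - w * x)"
      using pos diff_moebius [OF assms w] by (subst abs_minus_commute) (simp add: abs_mult)
    then show ?thesis
      using abs_moebius_less_1 [OF assms w] w pos
      by (auto simp: pv_trunc_def moebius_trunc_def pos_less_divide_eq abs_less_iff)
  qed
  show ?thesis
  proof (intro equalityI subsetI)
    \<comment> \<open>Since the map is an involution, a preimage of \<open>y\<close> is its own image.\<close>
    fix y assume y: "y \<in> pv_trunc x \<epsilon>"
    then have *: "\<bar>y\<bar> < 1" by (auto simp: pv_trunc_def)
    then show "y \<in> moebius x ` moebius_trunc x \<epsilon>"
      using y iff [of "moebius x y"] moebius_moebius [OF assms *] abs_moebius_less_1 [OF assms *]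
      by (metis image_eqI)
  qed (use iff in \<open>auto simp: moebius_trunc_def\<close>)
qed

text \<open>
  The integrand of \<open>L u\<^sub>p(x)\<close> in the new variable, without the constant factor
  \<open>(1 - x\<^sup>2)\<^bsup>p - \<alpha>\<^esup>\<close>.
\<close>

definition transformed_integrand :: "real \<Rightarrow> real \<Rightarrow> real \<Rightarrow> real \<Rightarrow> real" where
  "transformed_integrand \<alpha> x p w =
    ((1 - w * x) powr (\<alpha> - 1 - 2 * p) * (1 - w\<^sup>2) powr p - (1 - w * x) powr (\<alpha> - 1)) / \<bar>w\<bar> powr (1 + \<alpha>)"

lemma transformed_integrand_eq:
  assumes "\<bar>w\<bar> < 1"
  shows "transformed_integrand \<alpha> x p w = I_integrand \<alpha> x p w
    + (pv_kernel \<alpha> p w - (1 - w * x) powr (\<alpha> - 1) * pv_kernel \<alpha> 0 w)"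
proof -
  have "1 - w\<^sup>2 \<noteq> 0"
    using assms abs_square_less_1 [of w] by auto
  then show ?thesis
    by (simp add: transformed_integrand_def I_integrand_eq pv_kernel_def diff_divide_distrib algebra_simps)
qed

text \<open>
  The powers of \<open>A = 1 - x\<^sup>2\<close> combine to \<open>1 + p - (1 + \<alpha>) = p - \<alpha>\<close>; those of \<open>B = 1 - w x\<close> combine to
  \<open>- 2 - 2p + (1 + \<alpha>) = \<alpha> - 1 - 2p\<close> in the term coming from \<open>u\<^sub>p(y)\<close> and to
  \<open>- 2 + (1 + \<alpha>) = \<alpha> - 1\<close> in the term coming from \<open>u\<^sub>p(x)\<close>.
\<close>

lemma L_integrand_moebius:
  assumes x: "\<bar>x\<bar> < 1" and w: "\<bar>w\<bar> < 1" "w \<noteq> 0"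
  shows "\<bar>- ((1 - x\<^sup>2) / (1 - w * x)\<^sup>2)\<bar> * L_integrand \<alpha> (u_pow p) x (moebius x w) =
    (1 - x\<^sup>2) powr (p - \<alpha>) * transformed_integrand \<alpha> x p w"
proof -
  define A where "A = 1 - x\<^sup>2"
  define B where "B = 1 - w * x"
  define C where "C = 1 - w\<^sup>2"
  have pos: "A > 0" "B > 0" "C > 0" "\<bar>w\<bar> > 0"
    using assms one_minus_mult_pos [of x w] by (auto simp: A_def B_def C_def abs_square_less_1)
  have u: "u_pow p (moebius x w) = A powr p * C powr p / B powr (2 * p)"
  proof -
    have "(B\<^sup>2) powr p = B powr (2 * p)"
      using pos by (simp add: powr_powr flip: powr_numeral)
    then show ?thesis
      using pos one_minus_moebius_square [OF x w(1)]
      by (simp add: u_pow_def A_def [symmetric] B_def [symmetric] C_def [symmetric] powr_divide powr_mult)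
  qed
  have d: "\<bar>x - moebius x w\<bar> powr (1 + \<alpha>) = \<bar>w\<bar> powr (1 + \<alpha>) * (A * A powr \<alpha>) / (B\<^sup>2 * B powr (\<alpha> - 1))"
  proof -
    have "\<bar>x - moebius x w\<bar> = \<bar>w\<bar> * A / B"
      using pos by (simp add: diff_moebius [OF x w(1)] abs_mult A_def B_def)
    moreover have "A powr (1 + \<alpha>) = A * A powr \<alpha>" "B powr (1 + \<alpha>) = B\<^sup>2 * B powr (\<alpha> - 1)"
      using pos powr_add [of B 2 "\<alpha> - 1"] by (simp_all add: powr_add)
    ultimately show ?thesis
      using pos by (simp add: powr_divide powr_mult)
  qed
  have q: "B powr (\<alpha> - 1 - 2 * p) = B powr (\<alpha> - 1) / B powr (2 * p)" and a: "A powr (p - \<alpha>) = A powr p / A powr \<alpha>"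
    by (simp_all add: powr_diff)
  have "\<bar>- (A / B\<^sup>2)\<bar> * ((u_pow p (moebius x w) - A powr p) / \<bar>x - moebius x w\<bar> powr (1 + \<alpha>)) =
      A powr (p - \<alpha>) * ((B powr (\<alpha> - 1 - 2 * p) * C powr p - B powr (\<alpha> - 1)) / \<bar>w\<bar> powr (1 + \<alpha>))"
    unfolding u d q a using pos by (simp add: field_simps)
  then show ?thesis
    by (simp add: L_integrand_def transformed_integrand_def u_pow_def A_def B_def C_def)
qed

lemma moebius_change_of_variables:
  assumes "0 < \<alpha>" "\<bar>x\<bar> < 1" "\<epsilon> > 0"
    and "transformed_integrand \<alpha> x p absolutely_integrable_on moebius_trunc x \<epsilon>"
  shows "L_integrand \<alpha> (u_pow p) x absolutely_integrable_on pv_trunc x \<epsilon>"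
    and "(LINT y:pv_trunc x \<epsilon>|lebesgue. L_integrand \<alpha> (u_pow p) x y) =
      (1 - x\<^sup>2) powr (p - \<alpha>) * (LINT w:moebius_trunc x \<epsilon>|lebesgue. transformed_integrand \<alpha> x p w)"
proof -
  let ?S = "moebius_trunc x \<epsilon>"
  let ?f = "\<lambda>w. (1 - x\<^sup>2) powr (p - \<alpha>) * transformed_integrand \<alpha> x p w"
  let ?g = "\<lambda>w. \<bar>- ((1 - x\<^sup>2) / (1 - w * x)\<^sup>2)\<bar> * L_integrand \<alpha> (u_pow p) x (moebius x w)"
  have S: "\<bar>w\<bar> < 1" "w \<noteq> 0" if "w \<in> ?S" for w
    using that assms by (auto simp: moebius_trunc_def)
  have eq: "?f w = ?g w" if "w \<in> ?S" for w
    using L_integrand_moebius [OF assms(2) S [OF that]] by simp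
  have f: "?f absolutely_integrable_on ?S"
    using assms(4) by (rule set_integrable_mult_right)
  then have g: "?g absolutely_integrable_on ?S"
    using eq by (elim absolutely_integrable_spike [OF _ negligible_empty]) auto
  have "inj_on (moebius x) ?S"
    by (metis S(1) assms(2) inj_onI moebius_moebius)
  from has_absolute_integral_change_of_variables_1' [OF sets_moebius_trunc
      moebius_has_derivative [OF assms(2) S(1)] this,
      of "L_integrand \<alpha> (u_pow p) x" "integral ?S ?g"]
  have *: "L_integrand \<alpha> (u_pow p) x absolutely_integrable_on pv_trunc x \<epsilon>"
    "integral (pv_trunc x \<epsilon>) (L_integrand \<alpha> (u_pow p) x) = integral ?S ?g"
    using g unfolding moebius_image_trunc [OF assms(2)] by auto
  then show "L_integrand \<alpha> (u_pow p) x absolutely_integrable_on pv_trunc x \<epsilon>"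
    by simp
  have "(LINT y:pv_trunc x \<epsilon>|lebesgue. L_integrand \<alpha> (u_pow p) x y) = integral ?S ?g"
    using * by (simp add: set_lebesgue_integral_eq_integral)
  also have "\<dots> = integral ?S ?f"
    using eq by (intro Henstock_Kurzweil_Integration.integral_cong) simp
  also have "\<dots> = (1 - x\<^sup>2) powr (p - \<alpha>) * integral ?S (transformed_integrand \<alpha> x p)"
    by simp
  also have "integral ?S (transformed_integrand \<alpha> x p) = (LINT w:?S|lebesgue. transformed_integrand \<alpha> x p w)"
    using assms(4) by (simp add: set_lebesgue_integral_eq_integral)
  finally show "(LINT y:pv_trunc x \<epsilon>|lebesgue. L_integrand \<alpha> (u_pow p) x y) =
      (1 - x\<^sup>2) powr (p - \<alpha>) * (LINT w:?S|lebesgue. transformed_integrand \<alpha> x p w)" .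
qed

section \<open>Replacing the transformed truncation by a symmetric one\<close>

text \<open>
  The numerator is continuously differentiable near \<open>0\<close> and vanishes at \<open>0\<close>, which gains one power of
  \<open>|w|\<close> over the kernel.
\<close>

lemma transformed_integrand_bound:
  assumes "\<bar>x\<bar> < 1"
  obtains C where "C \<ge> 0"
    "\<And>w. \<bar>w\<bar> \<le> 1 / 2 \<Longrightarrow> \<bar>transformed_integrand \<alpha> x p w\<bar> \<le> C * \<bar>w\<bar> powr (- \<alpha>)"
proof -
  define q where "q = \<alpha> - 1 - 2 * p"
  define G where "G w = (1 - w * x) powr q * (1 - w\<^sup>2) powr p - (1 - w * x) powr (\<alpha> - 1)" for w
  define G' where "G' w = q * (1 - w * x) powr (q - 1) * (- x) * (1 - w\<^sup>2) powr p
    + (1 - w * x) powr q * (p * (1 - w\<^sup>2) powr (p - 1) * (- 2 * w))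
    - (\<alpha> - 1) * (1 - w * x) powr (\<alpha> - 1 - 1) * (- x)" for w
  have pos: "1 - w * x > 0" "1 - w\<^sup>2 > 0" if "w \<in> {- (1 / 2)..1 / 2}" for w
    using that one_minus_mult_pos [OF assms, of w] abs_square_less_1 [of w] by auto
  have deriv: "(G has_real_derivative G' w) (at w within T)" if "w \<in> {- (1 / 2)..1 / 2}" for w T
    unfolding G_def G'_def using pos [OF that] by (auto intro!: derivative_eq_intros)
  have "continuous_on {- (1 / 2)..1 / 2} G'"
    unfolding G'_def [abs_def] by (intro continuous_intros) (auto dest: pos)
  then have "bounded (G' ` {- (1 / 2)..1 / 2})"
    by (intro compact_imp_bounded compact_continuous_image compact_Icc)
  then obtain C where C: "\<forall>w\<in>{- (1 / 2)..1 / 2}. \<bar>G' w\<bar> \<le> C"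
    by (auto simp: bounded_iff)
  show ?thesis
  proof
    have "\<bar>G' 0\<bar> \<le> C"
      using C by auto
    then show "C \<ge> 0" by linarith
    fix w :: real assume w: "\<bar>w\<bar> \<le> 1 / 2"
    then have "w \<in> {- (1 / 2)..1 / 2}" by auto
    then have "norm (G w - G 0) \<le> C * norm (w - 0)"
      using C deriv by (intro field_differentiable_bound [of "{- (1 / 2)..1 / 2}"]) auto
    then have G: "\<bar>G w\<bar> \<le> C * \<bar>w\<bar>"
      by (simp add: G_def)
    show "\<bar>transformed_integrand \<alpha> x p w\<bar> \<le> C * \<bar>w\<bar> powr (- \<alpha>)"
    proof (cases "w = 0")
      case False
      have "\<bar>transformed_integrand \<alpha> x p w\<bar> = \<bar>G w\<bar> / \<bar>w\<bar> powr (1 + \<alpha>)"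
        by (simp add: transformed_integrand_def G_def q_def)
      also have "\<dots> \<le> C * \<bar>w\<bar> / \<bar>w\<bar> powr (1 + \<alpha>)"
        using G by (intro divide_right_mono) auto
      also have "\<dots> = C * \<bar>w\<bar> powr (- \<alpha>)"
        using False by (simp add: powr_add powr_minus field_simps)
      finally show ?thesis .
    qed (simp add: transformed_integrand_def)
  qed
qed

text \<open>
  The two sets differ inside \<open>r \<le> |w| \<le> R\<close>, a set of measure \<open>2 (R - r)\<close> on which
  \<open>|w|\<^bsup>-\<alpha>\<^esup> \<le> r\<^bsup>-\<alpha>\<^esup>\<close>.
\<close>

lemma integral_change_of_truncation_le:
  assumes f: "f absolutely_integrable_on pv_trunc 0 r"
    and C: "C \<ge> 0" "\<And>w. \<bar>w\<bar> \<le> 1 / 2 \<Longrightarrow> \<bar>f w\<bar> \<le> C * \<bar>w\<bar> powr (- \<alpha>)" and "\<alpha> \<ge> 0"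
    and r: "0 < r" "r \<le> R" "R \<le> 1 / 2"
    and S: "S \<in> sets lebesgue" "pv_trunc 0 R \<subseteq> S" "S \<subseteq> pv_trunc 0 r"
  shows "\<bar>(LINT w:S|lebesgue. f w) - (LINT w:pv_trunc 0 r|lebesgue. f w)\<bar> \<le> 2 * C * (r powr (- \<alpha>) * (R - r))"
proof -
  define D where "D = pv_trunc 0 r - S"
  have D: "D \<in> sets lebesgue" "D \<subseteq> {-R..-r} \<union> {r..R}"
  proof -
    show "D \<in> sets lebesgue"
      using S by (auto simp: D_def)
    have "r < \<bar>w\<bar> \<and> \<bar>w\<bar> \<le> R" if "w \<in> D" for w
      using S(2) that by (force simp: D_def pv_trunc_def)
    then show "D \<subseteq> {-R..-r} \<union> {r..R}"
      by (force simp: abs_if split: if_splits)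
  qed
  have split: "pv_trunc 0 r = S \<union> D" "S \<inter> D = {}"
    using S by (auto simp: D_def)
  have fS: "f absolutely_integrable_on S" and fD: "f absolutely_integrable_on D"
    using f S D(1) by (auto intro: set_integrable_subset simp: D_def)
  have "(LINT w:pv_trunc 0 r|lebesgue. f w) = (LINT w:S|lebesgue. f w) + (LINT w:D|lebesgue. f w)"
    unfolding split(1) using split(2) fS fD by (rule set_integral_Un)
  then have "\<bar>(LINT w:S|lebesgue. f w) - (LINT w:pv_trunc 0 r|lebesgue. f w)\<bar> = norm (integral D f)"
    using set_lebesgue_integral_eq_integral(2) [OF fD] by simp
  also have "\<dots> \<le> C * r powr (- \<alpha>) * measure lebesgue D"
  proof (rule integral_norm_bound_integral')
    fix w assume "w \<in> D"
    then have w: "\<bar>w\<bar> \<le> 1 / 2" "r \<le> \<bar>w\<bar>"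
      using D(2) r by auto
    have "\<bar>f w\<bar> \<le> C * \<bar>w\<bar> powr (- \<alpha>)"
      using w C by simp
    also have "\<bar>w\<bar> powr (- \<alpha>) \<le> r powr (- \<alpha>)"
      using w r \<open>\<alpha> \<ge> 0\<close> by (intro powr_mono2') auto
    finally show "norm (f w) \<le> C * r powr (- \<alpha>)"
      using C(1) by (simp add: mult_left_mono)
  next
    show "f \<in> borel_measurable (lebesgue_on D)"
      using fD absolutely_integrable_measurable D(1) by blast
    have "bounded D"
      using D(2) by (rule bounded_subset [rotated]) (simp add: bounded_closed_interval)
    then have "D \<in> lmeasurable"
      using D(1) by (rule bounded_set_imp_lmeasurable)
    then show "((\<lambda>_. C * r powr (- \<alpha>)) has_integral C * r powr (- \<alpha>) * measure lebesgue D) D"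
      using has_integral_mult_right [of "\<lambda>_. 1" "measure lebesgue D" D "C * r powr (- \<alpha>)"]
      by (simp add: lmeasurable_iff_integrable_on lmeasure_integral integrable_integral)
  qed (fact D)
  also have "\<dots> \<le> C * r powr (- \<alpha>) * (2 * (R - r))"
  proof -
    have "measure lebesgue D \<le> measure lebesgue ({-R..-r} \<union> {r..R})"
      using D by (intro measure_mono_fmeasurable) auto
    also have "\<dots> \<le> measure lebesgue {-R..-r} + measure lebesgue {r..R}"
      by (rule measure_Un_le) simp_all
    finally show ?thesis
      using r C(1) by (intro mult_left_mono) auto
  qed
  finally show ?thesis
    by (simp only: mult_ac)
qed

lemma integral_change_of_truncation_tendsto:
  assumes f: "\<And>\<delta>. \<delta> > 0 \<Longrightarrow> f absolutely_integrable_on pv_trunc 0 \<delta>"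
    and C: "C \<ge> 0" "\<And>w. \<bar>w\<bar> \<le> 1 / 2 \<Longrightarrow> \<bar>f w\<bar> \<le> C * \<bar>w\<bar> powr (- \<alpha>)" and "\<alpha> \<ge> 0"
    and lim: "((\<lambda>\<delta>. LINT w:pv_trunc 0 \<delta>|lebesgue. f w) \<longlongrightarrow> l) (at_right 0)"
    and S: "\<forall>\<^sub>F \<epsilon> in at_right 0. S \<epsilon> \<in> sets lebesgue \<and> pv_trunc 0 (R \<epsilon>) \<subseteq> S \<epsilon> \<and> S \<epsilon> \<subseteq> pv_trunc 0 (r \<epsilon>)"
    and r: "\<forall>\<^sub>F \<epsilon> in at_right 0. 0 < r \<epsilon> \<and> r \<epsilon> \<le> R \<epsilon> \<and> R \<epsilon> \<le> 1 / 2" "(r \<longlongrightarrow> 0) (at_right 0)"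
    and gap: "((\<lambda>\<epsilon>. r \<epsilon> powr (- \<alpha>) * (R \<epsilon> - r \<epsilon>)) \<longlongrightarrow> 0) (at_right 0)"
  shows "((\<lambda>\<epsilon>. LINT w:S \<epsilon>|lebesgue. f w) \<longlongrightarrow> l) (at_right (0::real))"
proof -
  have "filterlim r (at_right 0) (at_right 0)"
    unfolding filterlim_at using r by (auto elim: eventually_mono)
  with lim have lim': "((\<lambda>\<epsilon>. LINT w:pv_trunc 0 (r \<epsilon>)|lebesgue. f w) \<longlongrightarrow> l) (at_right 0)"
    by (rule filterlim_compose)
  have "((\<lambda>\<epsilon>. (LINT w:S \<epsilon>|lebesgue. f w) - (LINT w:pv_trunc 0 (r \<epsilon>)|lebesgue. f w)) \<longlongrightarrow> 0) (at_right 0)"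
  proof (rule Lim_null_comparison)
    show "\<forall>\<^sub>F \<epsilon> in at_right 0. norm ((LINT w:S \<epsilon>|lebesgue. f w) - (LINT w:pv_trunc 0 (r \<epsilon>)|lebesgue. f w))
        \<le> 2 * C * (r \<epsilon> powr (- \<alpha>) * (R \<epsilon> - r \<epsilon>))"
      using S r(1)
    proof eventually_elim
      case (elim \<epsilon>)
      then show ?case
        unfolding real_norm_def
        by (intro integral_change_of_truncation_le [OF f C \<open>\<alpha> \<ge> 0\<close>]) simp_all
    qed
    show "((\<lambda>\<epsilon>. 2 * C * (r \<epsilon> powr (- \<alpha>) * (R \<epsilon> - r \<epsilon>))) \<longlongrightarrow> 0) (at_right 0)"
      using gap by (rule tendsto_mult_right_zero)
  qed
  from tendsto_add [OF this lim'] show ?thesis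
    by simp
qed

text \<open>
  Bounding \<open>\<plusminus>w x\<close> by \<open>|w| |x|\<close> in \<open>\<epsilon> (1 - w x) < |w| (1 - x\<^sup>2)\<close> and solving for \<open>|w|\<close> gives the two radii.
\<close>

lemma moebius_trunc_sandwich:
  assumes "\<bar>x\<bar> < 1" "\<epsilon> > 0"
  shows "moebius_trunc x \<epsilon> \<subseteq> pv_trunc 0 (\<epsilon> / (1 - x\<^sup>2 + \<epsilon> * \<bar>x\<bar>))"
    and "\<epsilon> * \<bar>x\<bar> < 1 - x\<^sup>2 \<Longrightarrow> pv_trunc 0 (\<epsilon> / (1 - x\<^sup>2 - \<epsilon> * \<bar>x\<bar>)) \<subseteq> moebius_trunc x \<epsilon>"
proof -
  have wx: "\<bar>\<epsilon> * (w * x)\<bar> = \<epsilon> * (\<bar>w\<bar> * \<bar>x\<bar>)" for w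
    using assms by (simp add: abs_mult)
  have "1 - x\<^sup>2 > 0"
    using assms(1) by (simp add: abs_square_less_1)
  then have pos: "1 - x\<^sup>2 + \<epsilon> * \<bar>x\<bar> > 0"
    using assms by (simp add: add_pos_nonneg)
  show "moebius_trunc x \<epsilon> \<subseteq> pv_trunc 0 (\<epsilon> / (1 - x\<^sup>2 + \<epsilon> * \<bar>x\<bar>))"
  proof
    fix w assume w: "w \<in> moebius_trunc x \<epsilon>"
    then have "\<epsilon> * (1 - w * x) < \<bar>w\<bar> * (1 - x\<^sup>2)"
      by (simp add: moebius_trunc_def)
    then have "\<epsilon> < \<bar>w\<bar> * (1 - x\<^sup>2 + \<epsilon> * \<bar>x\<bar>)"
      using wx [of w] by (simp add: algebra_simps)
    then show "w \<in> pv_trunc 0 (\<epsilon> / (1 - x\<^sup>2 + \<epsilon> * \<bar>x\<bar>))"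
      using w pos by (simp add: moebius_trunc_def pv_trunc_def pos_divide_less_eq)
  qed
  show "pv_trunc 0 (\<epsilon> / (1 - x\<^sup>2 - \<epsilon> * \<bar>x\<bar>)) \<subseteq> moebius_trunc x \<epsilon>" if small: "\<epsilon> * \<bar>x\<bar> < 1 - x\<^sup>2"
  proof
    fix w assume w: "w \<in> pv_trunc 0 (\<epsilon> / (1 - x\<^sup>2 - \<epsilon> * \<bar>x\<bar>))"
    then have "\<epsilon> < \<bar>w\<bar> * (1 - x\<^sup>2 - \<epsilon> * \<bar>x\<bar>)"
      using small by (simp add: pv_trunc_def pos_divide_less_eq)
    then have "\<epsilon> * (1 - w * x) < \<bar>w\<bar> * (1 - x\<^sup>2)"
      using wx [of w] by (simp add: algebra_simps)
    then show "w \<in> moebius_trunc x \<epsilon>"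
      using w by (simp add: moebius_trunc_def pv_trunc_def)
  qed
qed

text \<open>
  The radii of the sandwich differ by \<open>O(\<epsilon>\<^sup>2)\<close> and are comparable to \<open>\<epsilon>\<close>, so the error is
  \<open>O(\<epsilon>\<^bsup>2 - \<alpha>\<^esup>)\<close>.  This is where \<open>\<alpha> < 2\<close> allows the asymmetric truncation to be ignored.
\<close>

lemma moebius_trunc_tendsto:
  assumes "0 < \<alpha>" "\<alpha> < 2" "\<bar>x\<bar> < 1"
    and f: "\<And>\<delta>. \<delta> > 0 \<Longrightarrow> f absolutely_integrable_on pv_trunc 0 \<delta>"
    and C: "C \<ge> 0" "\<And>w. \<bar>w\<bar> \<le> 1 / 2 \<Longrightarrow> \<bar>f w\<bar> \<le> C * \<bar>w\<bar> powr (- \<alpha>)"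
    and lim: "((\<lambda>\<delta>. LINT w:pv_trunc 0 \<delta>|lebesgue. f w) \<longlongrightarrow> l) (at_right 0)"
  shows "((\<lambda>\<epsilon>. LINT w:moebius_trunc x \<epsilon>|lebesgue. f w) \<longlongrightarrow> l) (at_right 0)"
proof -
  define A where "A = 1 - x\<^sup>2"
  have "A > 0"
    using assms(3) by (simp add: A_def abs_square_less_1)
  define r where "r \<epsilon> = \<epsilon> / (A + \<epsilon> * \<bar>x\<bar>)" for \<epsilon>
  define R where "R \<epsilon> = \<epsilon> / (A - \<epsilon> * \<bar>x\<bar>)" for \<epsilon>
  have lims: "((\<lambda>\<epsilon>. A - \<epsilon> * \<bar>x\<bar>) \<longlongrightarrow> A - 0 * \<bar>x\<bar>) (at_right 0)" "(R \<longlongrightarrow> 0 / (A - 0 * \<bar>x\<bar>)) (at_right 0)"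
    unfolding R_def [abs_def] using \<open>A > 0\<close> by (intro tendsto_intros; simp)+
  have small: "\<forall>\<^sub>F \<epsilon> in at_right 0. 0 < A - \<epsilon> * \<bar>x\<bar>" and half: "\<forall>\<^sub>F \<epsilon> in at_right 0. R \<epsilon> < 1 / 2"
    using \<open>A > 0\<close> by (intro order_tendstoD(1) [OF lims(1)] order_tendstoD(2) [OF lims(2)]; simp)+
  have pos: "\<forall>\<^sub>F \<epsilon> in at_right 0. (0::real) < \<epsilon>"
    by (rule eventually_at_right_less)
  show ?thesis
  proof (rule integral_change_of_truncation_tendsto [OF f C _ lim])
    show "\<forall>\<^sub>F \<epsilon> in at_right 0. moebius_trunc x \<epsilon> \<in> sets lebesgue \<and>
        pv_trunc 0 (R \<epsilon>) \<subseteq> moebius_trunc x \<epsilon> \<and> moebius_trunc x \<epsilon> \<subseteq> pv_trunc 0 (r \<epsilon>)"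
      using small pos
    proof eventually_elim
      case (elim \<epsilon>)
      then show ?case
        using moebius_trunc_sandwich [OF assms(3), of \<epsilon>] by (simp add: r_def R_def A_def)
    qed
    show "\<forall>\<^sub>F \<epsilon> in at_right 0. 0 < r \<epsilon> \<and> r \<epsilon> \<le> R \<epsilon> \<and> R \<epsilon> \<le> 1 / 2"
      using small pos half
    proof eventually_elim
      case (elim \<epsilon>)
      have "0 \<le> \<epsilon> * \<bar>x\<bar>" using elim by simp
      then show ?case
        using elim \<open>A > 0\<close> by (auto simp: r_def R_def intro!: divide_left_mono divide_pos_pos mult_pos_pos add_pos_nonneg)
    qed
    show "(r \<longlongrightarrow> 0) (at_right 0)"
      unfolding r_def [abs_def] using \<open>A > 0\<close> by (auto intro!: tendsto_eq_intros)
    have "((\<lambda>\<epsilon>. \<epsilon> powr (2 - \<alpha>) * ((A + \<epsilon> * \<bar>x\<bar>) powr \<alpha> * (2 * \<bar>x\<bar> / ((A + \<epsilon> * \<bar>x\<bar>) * (A - \<epsilon> * \<bar>x\<bar>)))))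
        \<longlongrightarrow> 0 powr (2 - \<alpha>) * ((A + 0 * \<bar>x\<bar>) powr \<alpha> * (2 * \<bar>x\<bar> / ((A + 0 * \<bar>x\<bar>) * (A - 0 * \<bar>x\<bar>))))) (at_right 0)"
      using assms \<open>A > 0\<close> by (intro tendsto_intros) (auto intro!: eventually_at_rightI [of 0 1])
    then have "((\<lambda>\<epsilon>. \<epsilon> powr (2 - \<alpha>) * ((A + \<epsilon> * \<bar>x\<bar>) powr \<alpha> * (2 * \<bar>x\<bar> / ((A + \<epsilon> * \<bar>x\<bar>) * (A - \<epsilon> * \<bar>x\<bar>)))))
        \<longlongrightarrow> 0) (at_right 0)"
      by simp
    then show "((\<lambda>\<epsilon>. r \<epsilon> powr (- \<alpha>) * (R \<epsilon> - r \<epsilon>)) \<longlongrightarrow> 0) (at_right 0)"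
    proof (rule Lim_transform_eventually)
      show "\<forall>\<^sub>F \<epsilon> in at_right 0.
          \<epsilon> powr (2 - \<alpha>) * ((A + \<epsilon> * \<bar>x\<bar>) powr \<alpha> * (2 * \<bar>x\<bar> / ((A + \<epsilon> * \<bar>x\<bar>) * (A - \<epsilon> * \<bar>x\<bar>)))) =
          r \<epsilon> powr (- \<alpha>) * (R \<epsilon> - r \<epsilon>)"
        using small pos
      proof eventually_elim
        case (elim \<epsilon>)
        then have p: "A + \<epsilon> * \<bar>x\<bar> > 0"
          using \<open>A > 0\<close> by (simp add: add_pos_nonneg)
        have 1: "\<epsilon> powr (2 - \<alpha>) = \<epsilon> powr (- \<alpha>) * \<epsilon>\<^sup>2"
          using elim powr_add [of \<epsilon> "- \<alpha>" 2] by simp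
        have 2: "r \<epsilon> powr (- \<alpha>) = \<epsilon> powr (- \<alpha>) * (A + \<epsilon> * \<bar>x\<bar>) powr \<alpha>"
          using elim p by (simp add: r_def powr_divide powr_minus field_simps)
        have 3: "R \<epsilon> - r \<epsilon> = \<epsilon>\<^sup>2 * (2 * \<bar>x\<bar> / ((A + \<epsilon> * \<bar>x\<bar>) * (A - \<epsilon> * \<bar>x\<bar>)))"
          using elim p by (simp add: r_def R_def field_simps power2_eq_square)
        show ?case
          unfolding 1 2 3 by (simp only: mult_ac)
      qed
    qed
  qed (use assms(1) in auto)
qed

section \<open>The formula and the special values\<close>

lemma L_integrand_tendsto:
  assumes "0 < \<alpha>" "\<alpha> < 2" "p > -1" "\<bar>x\<bar> < 1"
  shows "\<epsilon> > 0 \<Longrightarrow> L_integrand \<alpha> (u_pow p) x absolutely_integrable_on pv_trunc x \<epsilon>"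
    and "((\<lambda>\<epsilon>. LINT y:pv_trunc x \<epsilon>|lebesgue. L_integrand \<alpha> (u_pow p) x y) \<longlongrightarrow>
      (1 - x\<^sup>2) powr (p - \<alpha>) * (I_pv \<alpha> x p + ((1 - x) powr \<alpha> + (1 + x) powr \<alpha>
        - (2 * p + 2 - \<alpha>) * Beta (p + 1) (1 - \<alpha> / 2)) / \<alpha>)) (at_right 0)"
proof -
  let ?K = "\<lambda>w. pv_kernel \<alpha> p w - (1 - w * x) powr (\<alpha> - 1) * pv_kernel \<alpha> 0 w"
  note int = I_integrand_integrable [OF assms(2-4)] pv_kernel_difference_integrable [OF assms(2-4)]
  have eq: "transformed_integrand \<alpha> x p w = I_integrand \<alpha> x p w + ?K w" if "w \<in> pv_trunc 0 \<delta>" for w \<delta>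
    using that by (intro transformed_integrand_eq) (auto simp: pv_trunc_def)
  have T: "transformed_integrand \<alpha> x p absolutely_integrable_on pv_trunc 0 \<delta>" if "\<delta> > 0" for \<delta>
    using set_integral_add(1) [OF int [OF that]] eq
    by (elim absolutely_integrable_spike [OF _ negligible_empty]) auto
  have val: "(LINT w:pv_trunc 0 \<delta>|lebesgue. I_integrand \<alpha> x p w) + (LINT w:pv_trunc 0 \<delta>|lebesgue. ?K w) =
      (LINT w:pv_trunc 0 \<delta>|lebesgue. transformed_integrand \<alpha> x p w)" if "\<delta> > 0" for \<delta>
    unfolding set_integral_add(2) [OF int [OF that], symmetric]
    using eq by (intro set_lebesgue_integral_cong) auto
  have lim: "((\<lambda>\<delta>. LINT w:pv_trunc 0 \<delta>|lebesgue. transformed_integrand \<alpha> x p w) \<longlongrightarrow>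
      I_pv \<alpha> x p + ((1 - x) powr \<alpha> + (1 + x) powr \<alpha>
        - (2 * p + 2 - \<alpha>) * Beta (p + 1) (1 - \<alpha> / 2)) / \<alpha>) (at_right 0)"
    using tendsto_add [OF I_pv_tendsto [OF assms(2-4)] pv_kernel_difference_tendsto [OF assms]]
    by (rule Lim_transform_eventually) (auto intro!: eventually_at_rightI [of 0 1] val)
  obtain C where C: "C \<ge> 0" "\<And>w. \<bar>w\<bar> \<le> 1 / 2 \<Longrightarrow> \<bar>transformed_integrand \<alpha> x p w\<bar> \<le> C * \<bar>w\<bar> powr (- \<alpha>)"
    using transformed_integrand_bound [OF assms(4)] by blast
  have M: "transformed_integrand \<alpha> x p absolutely_integrable_on moebius_trunc x \<epsilon>" if "\<epsilon> > 0" for \<epsilon>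
  proof (rule set_integrable_subset)
    have "1 - x\<^sup>2 + \<epsilon> * \<bar>x\<bar> > 0"
      using assms(4) that by (intro add_pos_nonneg) (auto simp: abs_square_less_1)
    then show "transformed_integrand \<alpha> x p absolutely_integrable_on pv_trunc 0 (\<epsilon> / (1 - x\<^sup>2 + \<epsilon> * \<bar>x\<bar>))"
      using that by (intro T) simp
  qed (use moebius_trunc_sandwich(1) [OF assms(4) that] in auto)
  note cov = moebius_change_of_variables [OF assms(1,4) _ M]
  show "\<epsilon> > 0 \<Longrightarrow> L_integrand \<alpha> (u_pow p) x absolutely_integrable_on pv_trunc x \<epsilon>"
    by (rule cov(1))
  have "((\<lambda>\<epsilon>. (1 - x\<^sup>2) powr (p - \<alpha>) * (LINT w:moebius_trunc x \<epsilon>|lebesgue. transformed_integrand \<alpha> x p w)) \<longlongrightarrow>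
      (1 - x\<^sup>2) powr (p - \<alpha>) * (I_pv \<alpha> x p + ((1 - x) powr \<alpha> + (1 + x) powr \<alpha>
        - (2 * p + 2 - \<alpha>) * Beta (p + 1) (1 - \<alpha> / 2)) / \<alpha>)) (at_right 0)"
    by (intro tendsto_mult tendsto_const moebius_trunc_tendsto [OF assms(1,2,4) T C lim])
  then show "((\<lambda>\<epsilon>. LINT y:pv_trunc x \<epsilon>|lebesgue. L_integrand \<alpha> (u_pow p) x y) \<longlongrightarrow>
      (1 - x\<^sup>2) powr (p - \<alpha>) * (I_pv \<alpha> x p + ((1 - x) powr \<alpha> + (1 + x) powr \<alpha>
        - (2 * p + 2 - \<alpha>) * Beta (p + 1) (1 - \<alpha> / 2)) / \<alpha>)) (at_right 0)"
    by (rule Lim_transform_eventually) (auto intro!: eventually_at_rightI [of 0 1] simp: cov(2))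
qed

text \<open>
  Here \<open>\<alpha> - 1 - 2p = 2\<close>, so the second difference is exactly \<open>2 x\<^sup>2 w\<^sup>2\<close> and the kernel becomes the beta
  density.  The condition \<open>1 < \<alpha>\<close> is what makes \<open>p > -1\<close>.
\<close>

lemma I_pv_quadratic:
  assumes "1 < \<alpha>" "\<alpha> < 2" "\<bar>x\<bar> < 1" and p: "p = (\<alpha> - 3) / 2"
  shows "I_pv \<alpha> x p = x\<^sup>2 * Beta (p + 1) (1 - \<alpha> / 2)"
  unfolding I_pv_def
proof (rule pv_integralI)
  have "p > -1" using assms by simp
  have eq: "x\<^sup>2 * (2 * integral {\<epsilon><..<1} (beta_density \<alpha> p)) =
      (LINT w:pv_trunc 0 \<epsilon>|lebesgue. I_integrand \<alpha> x p w)" if "\<epsilon> \<in> {0<..<1}" for \<epsilon>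
  proof -
    have "(LINT w:pv_trunc 0 \<epsilon>|lebesgue. I_integrand \<alpha> x p w) =
        integral {\<epsilon><..<1} (\<lambda>w. ((1 - w * x) powr (\<alpha> - 1 - 2 * p) + (1 + w * x) powr (\<alpha> - 1 - 2 * p) - 2) * pv_kernel \<alpha> p w)"
      using assms \<open>p > -1\<close> that by (intro integral_I_integrand_fold) auto
    also have "\<dots> = integral {\<epsilon><..<1} (\<lambda>w. (2 * x\<^sup>2) * beta_density \<alpha> p w)"
    proof (rule Henstock_Kurzweil_Integration.integral_cong)
      fix w assume w: "w \<in> {\<epsilon><..<1}"
      have "\<alpha> - 1 - 2 * p = 2" using p by simp
      moreover have "1 - w * x > 0" "1 - w * (- x) > 0"
        using w that assms(3) by (intro one_minus_mult_pos; simp)+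
      ultimately have "(1 - w * x) powr (\<alpha> - 1 - 2 * p) + (1 + w * x) powr (\<alpha> - 1 - 2 * p) - 2 = 2 * x\<^sup>2 * w\<^sup>2"
        by (simp add: power2_eq_square algebra_simps)
      then show "((1 - w * x) powr (\<alpha> - 1 - 2 * p) + (1 + w * x) powr (\<alpha> - 1 - 2 * p) - 2) * pv_kernel \<alpha> p w =
          (2 * x\<^sup>2) * beta_density \<alpha> p w"
        using w that by (simp add: pv_kernel_eq_beta_density)
    qed
    finally show ?thesis
      by simp
  qed
  have "((\<lambda>\<epsilon>. x\<^sup>2 * (2 * integral {\<epsilon><..<1} (beta_density \<alpha> p))) \<longlongrightarrow> x\<^sup>2 * Beta (p + 1) (1 - \<alpha> / 2)) (at_right 0)"
    unfolding beta_density_integral(2) [OF assms(2) \<open>p > -1\<close>, symmetric]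
    using beta_density_integral(1) [OF assms(2) \<open>p > -1\<close>]
    by (intro tendsto_mult tendsto_const integral_truncate_left_tendsto set_lebesgue_integral_eq_integral(1))
  then show "((\<lambda>\<epsilon>. LINT w:pv_trunc 0 \<epsilon>|lebesgue. I_integrand \<alpha> x p w) \<longlongrightarrow> x\<^sup>2 * Beta (p + 1) (1 - \<alpha> / 2)) (at_right 0)"
    by (rule Lim_transform_eventually) (auto intro!: eventually_at_rightI [of 0 1] eq)
qed

text \<open>
  The exponent \<open>\<alpha> - 1 - 2p\<close> is \<open>1\<close> or \<open>0\<close>, so the second difference vanishes identically.
\<close>

lemma I_pv_eq_0:
  assumes "0 < \<alpha>" "\<alpha> < 2" "\<bar>x\<bar> < 1" and p: "p = (\<alpha> - 2) / 2 \<or> p = (\<alpha> - 1) / 2"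
  shows "I_pv \<alpha> x p = 0"
  unfolding I_pv_def
proof (rule pv_integralI)
  have "p > -1" using assms by auto
  have "0 = (LINT w:pv_trunc 0 \<epsilon>|lebesgue. I_integrand \<alpha> x p w)" if "\<epsilon> \<in> {0<..<1}" for \<epsilon>
  proof -
    have "(LINT w:pv_trunc 0 \<epsilon>|lebesgue. I_integrand \<alpha> x p w) =
        integral {\<epsilon><..<1} (\<lambda>w. ((1 - w * x) powr (\<alpha> - 1 - 2 * p) + (1 + w * x) powr (\<alpha> - 1 - 2 * p) - 2) * pv_kernel \<alpha> p w)"
      using assms \<open>p > -1\<close> that by (intro integral_I_integrand_fold) auto
    also have "\<dots> = integral {\<epsilon><..<1} (\<lambda>w. 0)"
    proof (rule Henstock_Kurzweil_Integration.integral_cong)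
      fix w assume w: "w \<in> {\<epsilon><..<1}"
      have "\<alpha> - 1 - 2 * p = 1 \<or> \<alpha> - 1 - 2 * p = 0" using p by auto
      moreover have "1 - w * x > 0" "1 - w * (- x) > 0"
        using w that assms(3) by (intro one_minus_mult_pos; simp)+
      ultimately show "((1 - w * x) powr (\<alpha> - 1 - 2 * p) + (1 + w * x) powr (\<alpha> - 1 - 2 * p) - 2) * pv_kernel \<alpha> p w = 0"
        by (elim disjE) (simp_all only:, simp_all)
    qed
    finally show ?thesis
      by simp
  qed
  then show "((\<lambda>\<epsilon>. LINT w:pv_trunc 0 \<epsilon>|lebesgue. I_integrand \<alpha> x p w) \<longlongrightarrow> 0) (at_right 0)"
    by (intro Lim_transform_eventually [OF tendsto_const]) (auto intro!: eventually_at_rightI [of 0 1])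
qed

theorem lemma5:
  fixes \<alpha> :: real
  assumes "0 < \<alpha>" and "\<alpha> < 2"
  shows "(\<forall>p>-1. \<forall>x\<in>{-1<..<1}.
            pv_convergent x (L_integrand \<alpha> (u_pow p) x) \<and>
            pv_convergent 0 (I_integrand \<alpha> x p) \<and>
            L_op \<alpha> (u_pow p) x =
              (1 - x\<^sup>2) powr (p - \<alpha>) / \<alpha> *
                ((1 - x) powr \<alpha> + (1 + x) powr \<alpha>
                 - (2 * p + 2 - \<alpha>) * Beta (p + 1) (1 - \<alpha> / 2)
                 + \<alpha> * I_pv \<alpha> x p)) \<and>
         (1 < \<alpha> \<longrightarrow>
            (\<forall>x\<in>{-1<..<1}. \<forall>p. p = (\<alpha> - 3) / 2 \<longrightarrow>
               I_pv \<alpha> x p = x\<^sup>2 * Beta (p + 1) (1 - \<alpha> / 2))) \<and>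
         (\<forall>x\<in>{-1<..<1}.
            I_pv \<alpha> x ((\<alpha> - 2) / 2) = 0 \<and> I_pv \<alpha> x ((\<alpha> - 1) / 2) = 0)"
proof (intro conjI allI ballI impI)
  fix p x :: real
  assume p: "p > -1" and "x \<in> {-1<..<1}"
  then have x: "\<bar>x\<bar> < 1" by auto
  note lim = L_integrand_tendsto [OF assms p x]
  show "pv_convergent x (L_integrand \<alpha> (u_pow p) x)"
    unfolding pv_convergent_def using lim by blast
  show "pv_convergent 0 (I_integrand \<alpha> x p)"
    using assms(2) p x by (rule pv_convergent_I_integrand)
  show "L_op \<alpha> (u_pow p) x =
      (1 - x\<^sup>2) powr (p - \<alpha>) / \<alpha> *
        ((1 - x) powr \<alpha> + (1 + x) powr \<alpha>
         - (2 * p + 2 - \<alpha>) * Beta (p + 1) (1 - \<alpha> / 2)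
         + \<alpha> * I_pv \<alpha> x p)"
    unfolding L_op_def pv_integralI [OF lim(2)] using assms(1) by (simp add: field_simps)
next
  fix x p :: real
  assume "1 < \<alpha>" "x \<in> {-1<..<1}" "p = (\<alpha> - 3) / 2"
  then show "I_pv \<alpha> x p = x\<^sup>2 * Beta (p + 1) (1 - \<alpha> / 2)"
    using assms(2) by (intro I_pv_quadratic) auto
next
  fix x :: real
  assume "x \<in> {-1<..<1}"
  then have x: "\<bar>x\<bar> < 1" by auto
  show "I_pv \<alpha> x ((\<alpha> - 2) / 2) = 0"
    using assms x by (rule I_pv_eq_0) simp
  show "I_pv \<alpha> x ((\<alpha> - 1) / 2) = 0"
    using assms x by (rule I_pv_eq_0) simp
qed

end
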